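(* Consider ${\rm APP}=\{{\rm APP}_{\infty,d}\}_{d\in\mathbb N}$ in the worst case setting for the absolute or normalized error criterion. Then for fixed $s,t>0$, EXP-$(s,t)$-WT for $\Lambda^{\rm all}$ is equivalent to EXP-$(s,t)$-WT for $\Lambda^{\rm std}$. In particular, EXP-WT for $\Lambda^{\rm all}$ is equivalent to EXP-WT for $\Lambda^{\rm std}$.
   Context: $\mathbb T^d=[0,1]^d$ is the torus with Lebesgue measure; $\hat f(\mathbf k)=\int f(\mathbf x)e^{-2\pi i\mathbf k\cdot\mathbf x}d\mathbf x$. For each $d$ let $\omega_d:\mathbb Z^d\to(0,\infty)$ with $\sum_{\mathbf k}\omega_d(\mathbf k)^{-2}<\infty$, and $H^{\omega_d}(\mathbb T^d)$ the Hilbert space of $f\in L_2(\mathbb T^d)$ with $\|f\|^2=\sum_{\mathbf k}|\hat f(\mathbf k)|^2\omega_d(\mathbf k)^2<\infty$. ${\rm APP}_{\infty,d}:H^{\omega_d}(\mathbb T^d)\to L_\infty(\mathbb T^d)$ (sup norm), $f\mapsto f$. $\Lambda^{\rm all}$: all continuous linear functionals; $\Lambda^{\rm std}$: point evaluations. $e(n,{\rm APP}_{\infty,d};\Lambda)$: infimum over algorithms $A(f)=\phi(L_1f,\dots,L_nf)$, $L_i\in\Lambda$, $\phi$ arbitrary, of $\sup_{\|f\|\le1}\|f-A(f)\|_\infty$; $e(0,{\rm APP}_{\infty,d})=\sup_{\|f\|\le1}\|f\|_\infty$. $n^\star(\varepsilon,d;\Lambda)=\inf\{n\ge0:e(n,{\rm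 APP}_{\infty,d};\Lambda)\le\varepsilon{\rm CRI}_d\}$ with ${\rm CRI}_d=1$ (ABS) or $e(0,{\rm APP}_{\infty,d})$ (NOR). EXP-$(s,t)$-WT for $\Lambda$: $\lim_{\varepsilon^{-1}+d\to\infty}\ln n^\star(\varepsilon,d;\Lambda)/((1+\ln\varepsilon^{-1})^s+d^t)=0$ ($d\in\mathbb N$, $\varepsilon\in(0,1)$). EXP-WT is EXP-$(1,1)$-WT. *)

theory Defs
  imports "HOL-Analysis.Analysis" "HOL-Probability.Essential_Supremum"
begin

text \<open>Points of the torus T^d are represented by extensional functions
  x :: nat => real (coordinates i < d, undefined elsewhere); the fundamental
  domain is the cube [0,1]^d. Frequencies k in Z^d are extensional nat => int.\<close>

type_synonym tfun = "(nat \<Rightarrow> real) \<Rightarrow> complex"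

definition Rd :: "nat \<Rightarrow> (nat \<Rightarrow> real) set" where
  "Rd d = PiE {..<d} (\<lambda>_. UNIV)"

definition cube :: "nat \<Rightarrow> (nat \<Rightarrow> real) set" where
  "cube d = PiE {..<d} (\<lambda>_. {0..1})"

definition Zd :: "nat \<Rightarrow> (nat \<Rightarrow> int) set" where
  "Zd d = PiE {..<d} (\<lambda>_. UNIV)"

definition torus_measure :: "nat \<Rightarrow> (nat \<Rightarrow> real) measure" where
  "torus_measure d = restrict_space (PiM {..<d} (\<lambda>_. lborel)) (cube d)"

definition fourier :: "nat \<Rightarrow> tfun \<Rightarrow> (nat \<Rightarrow> int) \<Rightarrow> complex" where
  "fourier d f k = integral\<^sup>L (torus_measure d)
     (\<lambda>x. f x * cis (- 2 * pi * (\<Sum>i<d. real_of_int (k i) * x i)))"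

definition torus_cont :: "nat \<Rightarrow> tfun \<Rightarrow> bool" where
  "torus_cont d f \<longleftrightarrow> continuous_on (Rd d) f \<and>
     (\<forall>x\<in>Rd d. \<forall>j<d. f (x(j := x j + 1)) = f x)"

text \<open>The space H^{omega_d}(T^d) (each element identified with its continuous representative).\<close>
definition Hsp :: "(nat \<Rightarrow> (nat \<Rightarrow> int) \<Rightarrow> real) \<Rightarrow> nat \<Rightarrow> tfun set" where
  "Hsp \<omega> d = {f. torus_cont d f \<and>
     (\<lambda>k. (cmod (fourier d f k))\<^sup>2 * (\<omega> d k)\<^sup>2) summable_on Zd d}"

definition Hnorm :: "(nat \<Rightarrow> (nat \<Rightarrow> int) \<Rightarrow> real) \<Rightarrow> nat \<Rightarrow> tfun \<Rightarrow> real" where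
  "Hnorm \<omega> d f = sqrt (\<Sum>\<^sub>\<infinity>k\<in>Zd d. (cmod (fourier d f k))\<^sup>2 * (\<omega> d k)\<^sup>2)"

definition Hball :: "(nat \<Rightarrow> (nat \<Rightarrow> int) \<Rightarrow> real) \<Rightarrow> nat \<Rightarrow> tfun set" where
  "Hball \<omega> d = {f \<in> Hsp \<omega> d. Hnorm \<omega> d f \<le> 1}"

text \<open>L_infinity norm (essential supremum w.r.t. Lebesgue measure on the torus);
  non-measurable functions get norm infinity.\<close>
definition Linf_norm :: "nat \<Rightarrow> tfun \<Rightarrow> ereal" where
  "Linf_norm d g = esssup (torus_measure d) (\<lambda>x. ereal (cmod (g x)))"

definition Lall :: "(nat \<Rightarrow> (nat \<Rightarrow> int) \<Rightarrow> real) \<Rightarrow> nat \<Rightarrow> (tfun \<Rightarrow> complex) set" where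
  "Lall \<omega> d = {L. (\<forall>f\<in>Hsp \<omega> d. \<forall>g\<in>Hsp \<omega> d. \<forall>a b.
        L (\<lambda>x. a * f x + b * g x) = a * L f + b * L g) \<and>
     (\<exists>C. \<forall>f\<in>Hsp \<omega> d. cmod (L f) \<le> C * Hnorm \<omega> d f)}"

definition Lstd :: "nat \<Rightarrow> (tfun \<Rightarrow> complex) set" where
  "Lstd d = {(\<lambda>f. f x) | x. x \<in> cube d}"

definition err :: "(nat \<Rightarrow> (nat \<Rightarrow> int) \<Rightarrow> real) \<Rightarrow> nat \<Rightarrow> (tfun \<Rightarrow> complex) set \<Rightarrow> nat \<Rightarrow> ereal" where
  "err \<omega> d \<Lambda> n = Inf {(SUP f\<in>Hball \<omega> d.
        Linf_norm d (\<lambda>x. f x - \<phi> (map (\<lambda>L. L f) Ls) x)) | Ls \<phi>.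
        length Ls = n \<and> set Ls \<subseteq> \<Lambda>}"

definition err0 :: "(nat \<Rightarrow> (nat \<Rightarrow> int) \<Rightarrow> real) \<Rightarrow> nat \<Rightarrow> ereal" where
  "err0 \<omega> d = (SUP f\<in>Hball \<omega> d. Linf_norm d f)"

datatype crit = ABS | NOR

definition CRI :: "(nat \<Rightarrow> (nat \<Rightarrow> int) \<Rightarrow> real) \<Rightarrow> crit \<Rightarrow> nat \<Rightarrow> ereal" where
  "CRI \<omega> c d = (case c of ABS \<Rightarrow> 1 | NOR \<Rightarrow> err0 \<omega> d)"

text \<open>Information complexity; infinity if no n achieves the error.\<close>
definition nstar :: "(nat \<Rightarrow> (nat \<Rightarrow> int) \<Rightarrow> real) \<Rightarrow> crit \<Rightarrow> (nat \<Rightarrow> (tfun \<Rightarrow> complex) set)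
    \<Rightarrow> real \<Rightarrow> nat \<Rightarrow> enat" where
  "nstar \<omega> c \<Lambda> \<epsilon> d = Inf {enat n | n. err \<omega> d (\<Lambda> d) n \<le> ereal \<epsilon> * CRI \<omega> c d}"

definition EXP_WT :: "(nat \<Rightarrow> (nat \<Rightarrow> int) \<Rightarrow> real) \<Rightarrow> crit \<Rightarrow> real \<Rightarrow> real
    \<Rightarrow> (nat \<Rightarrow> (tfun \<Rightarrow> complex) set) \<Rightarrow> bool" where
  "EXP_WT \<omega> c s t \<Lambda> \<longleftrightarrow> (\<forall>\<eta>>0. \<exists>R. \<forall>d\<ge>1. \<forall>\<epsilon>. 0 < \<epsilon> \<and> \<epsilon> < 1 \<and> 1 / \<epsilon> + real d > R \<longrightarrow>
      nstar \<omega> c \<Lambda> \<epsilon> d \<noteq> \<infinity> \<and>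
      ln (real (the_enat (nstar \<omega> c \<Lambda> \<epsilon> d)))
        \<le> \<eta> * ((1 + ln (1 / \<epsilon>)) powr s + real d powr t))"

end

theory Submission
  imports Defs
begin

text \<open>Write \<sigma>(k) = 1 / \<omega>(k) and, for a finite set I of frequencies, let T(I) be the sum of \<sigma>(k)^2 over
  k outside I. Both classes of information are compared with T(I)^(1/2).

  Lower bound: n linear functionals on the span of the characters with frequencies in a finite set J
  leave, for every x, the part of the kernel section at x that is orthogonal to them, and this is a
  worst case function at x. Averaging its squared norm over x gives the sum of \<sigma>(k)^2 (1 - p(k)) with
  weights 0 \<le> p \<le> 1 of total mass at most n. Hence T(I) is at most the squared error for I
  consisting of the n largest \<sigma>(k).

  Upper bound: let m \<ge> card I, and sample on the orbit j z (mod 1) with j < 16 m^3, where z is chosen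
  by counting modulo a prime such that the numbers exp(2 \<pi> i k z), k in I, are separated by 1/(2 m^2).
  The geometric sums arising as aliasing coefficients are then so small that a function g vanishing
  at all samples has \<Sum> |g^(k)| over I at most 4 times the same sum over the complement of I.
  So the error is at most 10 T(I)^(1/2).

  Consequently the complexity for function values at \<epsilon> is at most 16 (n + 1)^3, where n is the
  complexity for arbitrary linear information at \<epsilon>/10, and the polynomial loss is invisible to ln.\<close>

section \<open>Characters and Lebesgue measure on the torus\<close>

text \<open>Both bounds meet in T(I) because every character has modulus 1: on functions with
  spectrum outside I, evaluation at x has squared norm T(I) for every x. The worst case over x thus
  agrees with the average over x, and averaging costs the lower bound nothing.

  The obstacle for function values is that finitely many points cannot separate infinitely many
  frequencies; only those in I are separated, and a frequency outside I may alias fully with one of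
  them, but not with two. This fixes the constants. All but one frequency of I keep distance 1/(4
  m^2), so the geometric sums give at most 2 times 4 m^2 / (16 m^3) = 1/(2 m) each and 1/2 over I.
  With S and R the sums of |g^(k)| over I and over its complement, S \<le> S/2 + 2 R, so S + R \<le>
  5 R; and R \<le> 2 T(I)^(1/2) because g is a difference of two functions of the unit ball.

  Any count polynomial in n would serve as well, which is why an elementary construction of points
  suffices.\<close>

definition char :: "nat \<Rightarrow> (nat \<Rightarrow> int) \<Rightarrow> (nat \<Rightarrow> real) \<Rightarrow> complex" where
  "char d k x = cis (2 * pi * (\<Sum>i<d. real_of_int (k i) * x i))"

lemma cube_subset_Rd: "cube d \<subseteq> Rd d"
  by (auto simp: cube_def Rd_def PiE_iff)

lemma cube_in_sets: "cube d \<in> sets (PiM {..<d} (\<lambda>_. lborel :: real measure))"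
  unfolding cube_def by (intro sets_PiM_I_finite) auto

lemma space_torus_measure [simp]: "space (torus_measure d) = cube d"
  using sets.sets_into_space[OF cube_in_sets[of d]]
  by (auto simp: torus_measure_def space_restrict_space)

lemma emeasure_torus_box:
  assumes "\<And>i. i < d \<Longrightarrow> A i \<in> sets borel" "\<And>i. i < d \<Longrightarrow> A i \<subseteq> {0..1}"
  shows "emeasure (torus_measure d) (PiE {..<d} A) = (\<Prod>i<d. emeasure lborel (A i))"
proof -
  interpret product_sigma_finite "\<lambda>_::nat. lborel :: real measure" ..
  have "PiE {..<d} A \<subseteq> cube d"
    unfolding cube_def by (rule PiE_mono) (use assms in auto)
  then have "emeasure (torus_measure d) (PiE {..<d} A) = emeasure (PiM {..<d} (\<lambda>_. lborel)) (PiE {..<d} A)"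
    unfolding torus_measure_def
    by (intro emeasure_restrict_space) (use cube_in_sets[of d] sets.Int_space_eq2 in auto)
  also have "\<dots> = (\<Prod>i<d. emeasure lborel (A i))"
    by (intro emeasure_PiM) (use assms in auto)
  finally show ?thesis .
qed

lemma torus_box_in_sets:
  assumes "\<And>i. i < d \<Longrightarrow> A i \<in> sets borel" "\<And>i. i < d \<Longrightarrow> A i \<subseteq> {0..1}"
  shows "PiE {..<d} A \<in> sets (torus_measure d)"
proof -
  have "PiE {..<d} A \<subseteq> cube d"
    unfolding cube_def by (rule PiE_mono) (use assms in auto)
  moreover have "PiE {..<d} A \<in> sets (PiM {..<d} (\<lambda>_. lborel :: real measure))"
    by (intro sets_PiM_I_finite) (use assms in auto)
  ultimately show ?thesis
    unfolding torus_measure_def using cube_in_sets[of d]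
    by (subst sets_restrict_space_iff) (auto simp: sets.Int_space_eq2)
qed

lemma emeasure_torus_cube: "emeasure (torus_measure d) (cube d) = 1"
  unfolding cube_def by (subst emeasure_torus_box) auto

lemma measure_torus_cube [simp]: "measure (torus_measure d) (cube d) = 1"
  by (simp add: measure_def emeasure_torus_cube)

lemma finite_measure_torus: "finite_measure (torus_measure d)"
  by (rule finite_measureI) (simp add: emeasure_torus_cube)

text \<open>Borel measurability into \<open>nat \<Rightarrow> real\<close> is checked on every
  coordinate, so those with i \<ge> d are included; on the cube they are the constant
  \<open>undefined\<close>.\<close>

lemma measurable_torus_coordinate:
  "(\<lambda>x. x i) \<in> borel_measurable (torus_measure d)"
proof (cases "i < d")
  case True
  have "(\<lambda>x. x i) \<in> measurable (PiM {..<d} (\<lambda>_. lborel :: real measure)) lborel"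
    by (rule measurable_component_singleton) (use True in auto)
  then show ?thesis
    unfolding torus_measure_def by (intro measurable_restrict_space1) simp
next
  case False
  have "(\<lambda>x. x i) \<in> borel_measurable (torus_measure d) \<longleftrightarrow>
        (\<lambda>x. undefined :: real) \<in> borel_measurable (torus_measure d)"
    by (intro measurable_cong) (use False in \<open>auto simp: cube_def PiE_iff extensional_def\<close>)
  then show ?thesis by simp
qed

lemma borel_measurable_torus:
  assumes "continuous_on (Rd d) f"
  shows "f \<in> borel_measurable (torus_measure d)"
proof -
  have "(\<lambda>x. x) \<in> borel_measurable (torus_measure d)"
    by (rule measurable_coordinatewise_then_product) (rule measurable_torus_coordinate)
  then have "(\<lambda>x. x) \<in> measurable (torus_measure d) (restrict_space borel (Rd d))"
    by (rule measurable_restrict_space2[rotated]) (use cube_subset_Rd[of d] in auto)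
  from measurable_compose[OF this borel_measurable_continuous_on_restrict[OF assms]]
  show ?thesis by simp
qed

lemma integrable_torus:
  fixes f :: "(nat \<Rightarrow> real) \<Rightarrow> 'a :: {banach, second_countable_topology}"
  assumes "f \<in> borel_measurable (torus_measure d)" "\<And>x. x \<in> cube d \<Longrightarrow> norm (f x) \<le> B"
  shows "integrable (torus_measure d) f"
  by (rule finite_measure.integrable_const_bound[OF finite_measure_torus, where B = B])
     (use assms in auto)

lemma norm_integral_torus_le:
  fixes f :: "(nat \<Rightarrow> real) \<Rightarrow> complex"
  assumes "f \<in> borel_measurable (torus_measure d)" "\<And>x. x \<in> cube d \<Longrightarrow> cmod (f x) \<le> B"
  shows "cmod (integral\<^sup>L (torus_measure d) f) \<le> B"
proof -
  have "cmod (integral\<^sup>L (torus_measure d) f) \<le> (\<integral>x. cmod (f x) \<partial>torus_measure d)"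
    by (rule integral_norm_bound)
  also have "\<dots> \<le> (\<integral>x. B \<partial>torus_measure d)"
    by (intro integral_mono integrable_torus[where B = B] integrable_torus[where B = "\<bar>B\<bar>"])
       (use assms in auto)
  also have "\<dots> = B" by simp
  finally show ?thesis .
qed

lemma continuous_on_coordinate [continuous_intros]:
  "continuous_on A (\<lambda>x :: nat \<Rightarrow> real. x i)"
  by (rule continuous_on_product_coordinates[THEN continuous_on_subset]) auto

lemma continuous_on_cis_real [continuous_intros]:
  "continuous_on A f \<Longrightarrow> continuous_on A (\<lambda>x. cis (f x))"
  unfolding cis_conv_exp by (intro continuous_intros)

lemma continuous_on_char [continuous_intros]: "continuous_on A (char d k)"
  unfolding char_def by (intro continuous_intros)

lemma norm_char [simp]: "cmod (char d k x) = 1"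
  by (simp add: char_def)

lemma cnj_char_eq: "cnj (char d k x) = cis (- 2 * pi * (\<Sum>i<d. real_of_int (k i) * x i))"
  by (simp add: char_def cis_cnj)

lemma fourier_eq: "fourier d f k = (\<integral>x. f x * cnj (char d k x) \<partial>torus_measure d)"
  by (simp add: fourier_def cnj_char_eq)

lemma cis_2pi_int: "cis (2 * pi * of_int n) = 1"
  by (metis cis_multiple_2pi Ints_of_int)

lemma char_periodic: "j < d \<Longrightarrow> char d k (x(j := x j + 1)) = char d k x"
proof -
  assume j: "j < d"
  have "(\<Sum>i<d. real_of_int (k i) * (x(j := x j + 1)) i) = (\<Sum>i<d. real_of_int (k i) * x i + (if i = j then real_of_int (k j) else 0))"
    by (intro sum.cong) (auto simp: algebra_simps)
  also have "\<dots> = (\<Sum>i<d. real_of_int (k i) * x i) + real_of_int (k j)"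
    using j by (simp add: sum.distrib)
  finally show ?thesis
    unfolding char_def by (simp add: distrib_left cis_2pi_int flip: cis_mult)
qed

lemma torus_cont_char: "torus_cont d (char d k)"
  by (simp add: torus_cont_def continuous_on_char char_periodic)

lemma integral_cis_unit_interval:
  fixes m :: int
  shows "integrable lborel (\<lambda>t. indicator {0..1} t *\<^sub>R cis (2 * pi * (real_of_int m * t)))"
    and "(\<integral>t. indicator {0..1} t *\<^sub>R cis (2 * pi * (real_of_int m * t)) \<partial>lborel) = (if m = 0 then 1 else 0)"
proof -
  have c: "continuous_on {0..1} (\<lambda>t. cis (2 * pi * (real_of_int m * t)))"
    by (intro continuous_intros)
  show "integrable lborel (\<lambda>t. indicator {0..1} t *\<^sub>R cis (2 * pi * (real_of_int m * t)))"
    using borel_integrable_compact[OF _ c] by (simp add: set_integrable_def)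
  show "(\<integral>t. indicator {0..1} t *\<^sub>R cis (2 * pi * (real_of_int m * t)) \<partial>lborel) = (if m = 0 then 1 else 0)"
  proof (cases "m = 0")
    case True
    then show ?thesis by simp
  next
    case False
    define c where "c = \<i> * (2 * pi * real_of_int m)"
    have "c \<noteq> 0" using False by (simp add: c_def)
    define F where "F = (\<lambda>t::real. exp (c * of_real t) / c)"
    have F': "exp (c * of_real t) = cis (2 * pi * (real_of_int m * t))" for t
      by (simp add: cis_conv_exp c_def mult_ac)
    have "((\<lambda>z. exp (c * z) / c) has_field_derivative exp (c * z)) (at z)" for z
      using \<open>c \<noteq> 0\<close> by (auto intro!: derivative_eq_intros)
    then have "(F has_vector_derivative cis (2 * pi * (real_of_int m * t))) (at t within {0..1})" for t
      unfolding F_def F'[symmetric] by (rule has_vector_derivative_real_field)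
    then have "(\<integral>t. indicator {0..1} t *\<^sub>R cis (2 * pi * (real_of_int m * t)) \<partial>lborel) = F 1 - F 0"
      by (intro integral_FTC_Icc) (auto intro!: continuous_intros)
    also have "\<dots> = 0" by (simp add: F_def F' cis_2pi_int)
    finally show ?thesis using False by simp
  qed
qed

text \<open>The indicator of the cube and the character both factor over the coordinates, so the
  integral is a product of one-dimensional integrals, each 0 or 1.\<close>

lemma integral_char:
  "(\<integral>x. char d k x \<partial>torus_measure d) = (if \<forall>i<d. k i = 0 then 1 else 0)"
proof -
  interpret product_sigma_finite "\<lambda>_::nat. lborel :: real measure" ..
  let ?M = "PiM {..<d} (\<lambda>_. lborel :: real measure)"
  let ?g = "\<lambda>i t. indicator {0..1} t *\<^sub>R cis (2 * pi * (real_of_int (k i) * t))"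
  have *: "indicator (cube d) x *\<^sub>R char d k x = (\<Prod>i<d. ?g i (x i))" if x: "x \<in> space ?M" for x
  proof -
    have ind: "(indicator (cube d) x :: real) = (\<Prod>i<d. indicator {0..1} (x i))"
    proof (cases "x \<in> cube d")
      case True
      then have "x i \<in> {0..1}" if "i < d" for i using that by (auto simp: cube_def PiE_iff)
      then show ?thesis using True by (simp add: indicator_def)
    next
      case False
      then obtain i where "i < d" "x i \<notin> {0..1}"
        using x by (auto simp: cube_def space_PiM PiE_iff)
      then have "(\<Prod>i<d. indicator {0..1} (x i)) = (0::real)"
        by (intro prod_zero) (auto intro!: bexI[of _ i])
      then show ?thesis using False by simp
    qed
    have "char d k x = (\<Prod>i<d. cis (2 * pi * (real_of_int (k i) * x i)))"
      unfolding char_def by (simp add: cis_conv_exp sum_distrib_left exp_sum)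
    then show ?thesis unfolding ind by (simp add: scaleR_conv_of_real prod.distrib)
  qed
  have "(\<integral>x. char d k x \<partial>torus_measure d) = (\<integral>x. indicator (cube d) x *\<^sub>R char d k x \<partial>?M)"
    unfolding torus_measure_def using cube_in_sets[of d]
    by (intro integral_restrict_space) (auto simp: sets.Int_space_eq2)
  also have "\<dots> = (\<integral>x. (\<Prod>i<d. ?g i (x i)) \<partial>?M)"
    by (intro Bochner_Integration.integral_cong) (use * in auto)
  also have "\<dots> = (\<Prod>i<d. \<integral>t. ?g i t \<partial>lborel)"
    by (intro product_integral_prod) (auto simp: integral_cis_unit_interval)
  also have "\<dots> = (\<Prod>i<d. if k i = 0 then 1 else 0)"
    by (simp add: integral_cis_unit_interval)
  also have "\<dots> = (if \<forall>i<d. k i = 0 then 1 else 0)"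
    by (auto intro!: prod_zero)
  finally show ?thesis .
qed

lemma char_mult_cnj: "char d k x * cnj (char d l x) = char d (\<lambda>i. k i - l i) x"
  by (simp add: char_def cis_cnj cis_mult left_diff_distrib sum_subtractf right_diff_distrib)

lemma integral_char_mult_cnj:
  assumes "k \<in> Zd d" "l \<in> Zd d"
  shows "(\<integral>x. char d k x * cnj (char d l x) \<partial>torus_measure d) = (if k = l then 1 else 0)"
proof -
  have "(\<forall>i<d. k i - l i = 0) \<longleftrightarrow> k = l"
    using assms by (auto simp: Zd_def PiE_iff extensional_def fun_eq_iff) (metis not_less)
  then show ?thesis by (simp add: char_mult_cnj integral_char)
qed

lemma compact_cube: "compact (cube d)"
proof -
  \<comment> \<open>Extensionality is expressed by singleton factors, which turns the cube into a
    full product over all naturals, to which Tychonoff's theorem applies.\<close>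
  let ?S = "\<lambda>i. if i < d then {0..1} else {undefined :: real}"
  have eq: "cube d = PiE UNIV ?S"
    unfolding cube_def PiE_def Pi_def extensional_def by (intro set_eqI) (simp, metis)
  have "compactin (product_topology (\<lambda>_::nat. euclidean) UNIV) (PiE UNIV ?S)"
    by (subst compactin_PiE) auto
  then show ?thesis
    unfolding eq euclidean_product_topology by simp
qed

lemma bounded_on_cube:
  assumes "continuous_on (Rd d) f"
  obtains B where "B \<ge> 0" "\<And>x. x \<in> cube d \<Longrightarrow> norm (f x) \<le> B"
proof -
  have "continuous_on (cube d) f"
    using assms cube_subset_Rd by (rule continuous_on_subset)
  then have "bounded (f ` cube d)"
    using compact_cube by (intro compact_imp_bounded compact_continuous_image)
  then obtain B where "B > 0" "\<forall>y\<in>f ` cube d. norm y \<le> B"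
    unfolding bounded_pos by blast
  then show ?thesis by (intro that[of B]) auto
qed

lemma integrable_torus_continuous:
  fixes f :: "(nat \<Rightarrow> real) \<Rightarrow> 'a :: {banach, second_countable_topology}"
  assumes "continuous_on (Rd d) f"
  shows "integrable (torus_measure d) f"
proof -
  obtain B where "\<And>x. x \<in> cube d \<Longrightarrow> norm (f x) \<le> B"
    using bounded_on_cube[OF assms] by blast
  then show ?thesis
    by (intro integrable_torus[where B = B] borel_measurable_torus assms)
qed

lemma continuous_on_cnj_char [continuous_intros]: "continuous_on A (\<lambda>x. cnj (char d k x))"
  by (intro continuous_on_cnj continuous_on_char)

lemma torus_cont_diff:
  assumes "torus_cont d f" "torus_cont d g"
  shows "torus_cont d (\<lambda>x. f x - g x)"
  using assms unfolding torus_cont_def by (auto intro!: continuous_intros)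

lemma torus_cont_continuous: "torus_cont d f \<Longrightarrow> continuous_on (Rd d) f"
  by (simp add: torus_cont_def)

lemma integrable_fourier:
  assumes "torus_cont d f"
  shows "integrable (torus_measure d) (\<lambda>x. f x * cnj (char d k x))"
  by (intro integrable_torus_continuous continuous_intros torus_cont_continuous assms)

lemma fourier_lincomb:
  assumes "torus_cont d f" "torus_cont d g"
  shows "fourier d (\<lambda>x. a * f x + b * g x) k = a * fourier d f k + b * fourier d g k"
proof -
  have "fourier d (\<lambda>x. a * f x + b * g x) k =
      (\<integral>x. a * (f x * cnj (char d k x)) + b * (g x * cnj (char d k x)) \<partial>torus_measure d)"
    unfolding fourier_eq by (simp add: algebra_simps)
  also have "\<dots> = a * fourier d f k + b * fourier d g k"
    unfolding fourier_eq using assms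
    by (subst Bochner_Integration.integral_add) (auto intro!: integrable_fourier integrable_mult_right)
  finally show ?thesis .
qed

lemma fourier_diff:
  assumes "torus_cont d f" "torus_cont d g"
  shows "fourier d (\<lambda>x. f x - g x) k = fourier d f k - fourier d g k"
  using fourier_lincomb[OF assms, of 1 "-1" k] by simp

lemma torus_cont_trig:
  "finite J \<Longrightarrow> torus_cont d (\<lambda>x. \<Sum>k\<in>J. c k * char d k x)"
  unfolding torus_cont_def by (auto intro!: continuous_intros simp: char_periodic)

lemma fourier_trig:
  assumes "finite J" "J \<subseteq> Zd d" "l \<in> Zd d"
  shows "fourier d (\<lambda>x. \<Sum>k\<in>J. c k * char d k x) l = (if l \<in> J then c l else 0)"
proof -
  have "fourier d (\<lambda>x. \<Sum>k\<in>J. c k * char d k x) l =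
      (\<integral>x. (\<Sum>k\<in>J. c k * (char d k x * cnj (char d l x))) \<partial>torus_measure d)"
    unfolding fourier_eq by (simp add: sum_distrib_right mult.assoc)
  also have "\<dots> = (\<Sum>k\<in>J. c k * (\<integral>x. char d k x * cnj (char d l x) \<partial>torus_measure d))"
    by (subst Bochner_Integration.integral_sum)
       (auto intro!: integrable_mult_right integrable_fourier torus_cont_char)
  also have "\<dots> = (\<Sum>k\<in>J. c k * (if k = l then 1 else 0))"
    by (intro sum.cong refl, subst integral_char_mult_cnj) (use assms in auto)
  also have "\<dots> = (if l \<in> J then c l else 0)"
    using assms(1) by (simp add: sum.delta if_distrib cong: if_cong)
  finally show ?thesis .
qed

section \<open>Neighbourhoods in the cube: from almost everywhere to everywhere\<close>

lemma continuous_on_Rd_box: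
  fixes f :: "(nat \<Rightarrow> real) \<Rightarrow> 'a :: metric_space"
  assumes f: "continuous_on (Rd d) f" and x: "x \<in> Rd d" and "e > 0"
  obtains \<delta> where "\<delta> > 0"
    "\<And>y. y \<in> Rd d \<Longrightarrow> (\<And>i. i < d \<Longrightarrow> \<bar>y i - x i\<bar> < \<delta>) \<Longrightarrow> dist (f y) (f x) < e"
proof -
  obtain U where U: "open U" "U \<inter> Rd d = f -` ball (f x) e \<inter> Rd d"
    using f open_ball[of "f x" e] unfolding continuous_on_open_invariant by metis
  have "x \<in> U" using U x \<open>e > 0\<close> by auto
  have "openin (product_topology (\<lambda>_::nat. euclidean) UNIV) U"
    using U by (simp add: euclidean_product_topology)
  from product_topology_open_contains_basis[OF this \<open>x \<in> U\<close>]
  obtain X where X: "x \<in> PiE UNIV X" "\<And>i. open (X i)" "PiE UNIV X \<subseteq> U"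
    by auto
  have "\<exists>r>0. ball (x i) r \<subseteq> X i" for i
    using X(1) X(2)[of i] by (auto simp: open_contains_ball PiE_iff)
  then obtain r where r: "\<And>i. r i > 0" "\<And>i. ball (x i) (r i) \<subseteq> X i" by metis
  \<comment> \<open>Points of \<open>Rd d\<close> agree beyond d, so only the radii of the first d
    coordinates count; the 1 keeps the set nonempty for d = 0.\<close>
  define \<delta> where "\<delta> = Min (insert 1 (r ` {..<d}))"
  have "\<delta> > 0" unfolding \<delta>_def using r(1) by (subst Min_gr_iff) auto
  moreover have "dist (f y) (f x) < e"
    if y: "y \<in> Rd d" "\<And>i. i < d \<Longrightarrow> \<bar>y i - x i\<bar> < \<delta>" for y
  proof -
    have "y i \<in> X i" for i
    proof (cases "i < d")
      case True
      then have "\<delta> \<le> r i" unfolding \<delta>_def by (intro Min_le) auto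
      then have "y i \<in> ball (x i) (r i)"
        using y(2)[OF True] by (auto simp: dist_real_def)
      then show ?thesis using r(2) by blast
    next
      case False
      then have "y i = x i" using x y(1) by (auto simp: Rd_def PiE_iff extensional_def)
      then show ?thesis using X(1) by (auto simp: PiE_iff)
    qed
    then have "y \<in> U" using X(3) by (auto simp: PiE_iff)
    then show ?thesis using U(2) y(1) by (auto simp: dist_commute)
  qed
  ultimately show ?thesis by (rule that)
qed

text \<open>Clipping at 0 and 1 lets the same formula serve points on the faces of the cube: the box
  stays inside and keeps positive measure. It need not contain \<open>x\<close> itself.\<close>

definition cube_nbhd :: "nat \<Rightarrow> (nat \<Rightarrow> real) \<Rightarrow> real \<Rightarrow> (nat \<Rightarrow> real) set" where
  "cube_nbhd d x \<delta> = PiE {..<d} (\<lambda>i. {max 0 (x i - \<delta>)<..<min 1 (x i + \<delta>)})"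

lemma cube_nbhd_subset: "cube_nbhd d x \<delta> \<subseteq> cube d"
  unfolding cube_nbhd_def cube_def by (rule PiE_mono) auto

lemma cube_nbhd_in_sets: "cube_nbhd d x \<delta> \<in> sets (torus_measure d)"
  unfolding cube_nbhd_def by (rule torus_box_in_sets) auto

lemma cube_nbhd_dist: "y \<in> cube_nbhd d x \<delta> \<Longrightarrow> i < d \<Longrightarrow> \<bar>y i - x i\<bar> < \<delta>"
  using PiE_mem[of y "{..<d}" "\<lambda>i. {max 0 (x i - \<delta>)<..<min 1 (x i + \<delta>)}" i]
  by (simp add: cube_nbhd_def abs_less_iff)

lemma emeasure_cube_nbhd_pos:
  assumes "x \<in> cube d" "\<delta> > 0"
  shows "emeasure (torus_measure d) (cube_nbhd d x \<delta>) \<noteq> 0"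
proof -
  have "emeasure (torus_measure d) (cube_nbhd d x \<delta>) =
      (\<Prod>i<d. emeasure lborel {max 0 (x i - \<delta>)<..<min 1 (x i + \<delta>)})"
    unfolding cube_nbhd_def by (rule emeasure_torus_box) auto
  moreover have "emeasure lborel {max 0 (x i - \<delta>)<..<min 1 (x i + \<delta>)} \<noteq> 0" if "i < d" for i
  proof -
    have "0 \<le> x i" "x i \<le> 1" using assms(1) that by (auto simp: cube_def PiE_iff)
    then have "max 0 (x i - \<delta>) < min 1 (x i + \<delta>)" using assms(2) by auto
    then show ?thesis by (subst emeasure_lborel_Ioo) (auto simp: ennreal_eq_0_iff)
  qed
  ultimately show ?thesis by simp
qed

text \<open>Errors are essential suprema, while the lower bound evaluates at a prescribed point. By
  continuity a violation at \<open>x\<close> persists on a box of positive measure.\<close>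

lemma AE_torus_imp_everywhere:
  assumes f: "continuous_on (Rd d) f" and AE: "AE x in torus_measure d. cmod (f x) \<le> E"
    and x: "x \<in> cube d"
  shows "cmod (f x) \<le> E"
proof (rule ccontr)
  assume neg: "\<not> cmod (f x) \<le> E"
  obtain \<delta> where \<delta>: "\<delta> > 0"
    "\<And>y. y \<in> Rd d \<Longrightarrow> (\<And>i. i < d \<Longrightarrow> \<bar>y i - x i\<bar> < \<delta>) \<Longrightarrow> dist (f y) (f x) < cmod (f x) - E"
    using continuous_on_Rd_box[OF f subsetD[OF cube_subset_Rd x], of "cmod (f x) - E"] neg by auto
  have big: "\<not> cmod (f y) \<le> E" if "y \<in> cube_nbhd d x \<delta>" for y
  proof -
    have "dist (f y) (f x) < cmod (f x) - E"
      using \<delta>(2)[of y] that cube_nbhd_subset cube_subset_Rd cube_nbhd_dist by blast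
    moreover have "cmod (f x) \<le> cmod (f y) + dist (f y) (f x)"
      by (metis dist_commute dist_norm norm_triangle_sub)
    ultimately show ?thesis by simp
  qed
  have "AE y in torus_measure d. y \<notin> cube_nbhd d x \<delta>"
    using AE by eventually_elim (use big in auto)
  then have "emeasure (torus_measure d) (cube_nbhd d x \<delta>) = 0"
    by (subst (asm) AE_iff_measurable[OF cube_nbhd_in_sets[of d x \<delta>]])
       (use cube_nbhd_subset[of d x \<delta>] in auto)
  then show False using emeasure_cube_nbhd_pos[OF x \<delta>(1)] by simp
qed

section \<open>Fourier series of continuous functions\<close>

lemma char_mult_cos:
  assumes "i < d"
  shows "char d k x * of_real (cos (2 * pi * (x i - y))) =
    (cis (- 2 * pi * y) * char d (k(i := k i + 1)) x + cis (2 * pi * y) * char d (k(i := k i - 1)) x) / 2"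
proof -
  have upd: "char d (k(i := k i + m)) x = char d k x * cis (2 * pi * (real_of_int m * x i))" for m
  proof -
    have "(\<Sum>j<d. real_of_int ((k(i := k i + m)) j) * x j) =
        (\<Sum>j<d. real_of_int (k j) * x j + (if j = i then real_of_int m * x i else 0))"
      by (intro sum.cong) (auto simp: algebra_simps)
    also have "\<dots> = (\<Sum>j<d. real_of_int (k j) * x j) + real_of_int m * x i"
      using assms by (simp add: sum.distrib)
    finally show ?thesis by (simp add: char_def distrib_left flip: cis_mult)
  qed
  have cos: "of_real (cos t) = (cis t + cis (- t)) / 2" for t
    by (simp add: complex_eq_iff)
  have "cis (2 * pi * (x i - y)) = cis (- 2 * pi * y) * cis (2 * pi * x i)"
    "cis (- (2 * pi * (x i - y))) = cis (2 * pi * y) * cis (- (2 * pi * x i))"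
    by (simp_all add: cis_mult algebra_simps)
  then show ?thesis
    using upd[of 1] upd[of "- 1"] unfolding cos by (simp add: algebra_simps)
qed

lemma Zd_upd: "k \<in> Zd d \<Longrightarrow> i < d \<Longrightarrow> k(i := m) \<in> Zd d"
  by (auto simp: Zd_def PiE_iff extensional_def)

text \<open>Multiplication by p replaces a character by a combination of itself and its neighbours,
  by \<open>char_mult_cos\<close>; hence k is arbitrary in the induction on N, which starts from the
  vanishing Fourier coefficients.\<close>

lemma integral_peak_power_eq_0:
  fixes h :: tfun
  assumes h: "torus_cont d h" and 0: "\<And>k. k \<in> Zd d \<Longrightarrow> fourier d h k = 0"
    and p: "p = (\<lambda>x. a + (\<Sum>i<d. cos (2 * pi * (x i - y i))))"
    and "k \<in> Zd d"
  shows "(\<integral>x. h x * char d k x * of_real (p x ^ N) \<partial>torus_measure d) = 0"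
  using \<open>k \<in> Zd d\<close>
proof (induction N arbitrary: k)
  case 0
  \<comment> \<open>The negated frequency is restricted to stay extensional, as \<open>Zd d\<close>
    requires.\<close>
  define k' where "k' = restrict (\<lambda>i. - k i) {..<d}"
  have "k' \<in> Zd d" by (simp add: k'_def Zd_def)
  moreover have "cnj (char d k' x) = char d k x" for x
    by (simp add: char_def cis_cnj k'_def sum_negf)
  ultimately show ?case using assms(2)[of k'] by (simp add: fourier_eq)
next
  case (Suc N)
  have cp: "continuous_on (Rd d) p" unfolding p by (intro continuous_intros)
  have ch: "continuous_on (Rd d) h" using h by (rule torus_cont_continuous)
  let ?G = "\<lambda>l x. h x * char d l x * of_real (p x ^ N)"
  have int: "integrable (torus_measure d) (?G l)" for l
    by (intro integrable_torus_continuous continuous_intros cp ch)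
  let ?c = "\<lambda>i. cis (- 2 * pi * y i) / 2" and ?c' = "\<lambda>i. cis (2 * pi * y i) / 2"
  have "h x * char d k x * of_real (p x ^ Suc N) = of_real a * ?G k x +
      (\<Sum>i<d. ?c i * ?G (k(i := k i + 1)) x + ?c' i * ?G (k(i := k i - 1)) x)" for x
  proof -
    have "char d k x * of_real (p x) = of_real a * char d k x +
        (\<Sum>i<d. char d k x * of_real (cos (2 * pi * (x i - y i))))"
      by (simp add: p algebra_simps sum_distrib_left)
    also have "(\<Sum>i<d. char d k x * of_real (cos (2 * pi * (x i - y i)))) =
        (\<Sum>i<d. ?c i * char d (k(i := k i + 1)) x + ?c' i * char d (k(i := k i - 1)) x)"
      by (intro sum.cong refl, subst char_mult_cos) (auto simp: add_divide_distrib)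
    finally have *: "char d k x * of_real (p x) = of_real a * char d k x + \<dots>" .
    have "h x * char d k x * of_real (p x ^ Suc N) = (h x * of_real (p x ^ N)) * (char d k x * of_real (p x))"
      by (simp add: mult_ac)
    also have "\<dots> = of_real a * ?G k x +
      (\<Sum>i<d. ?c i * ?G (k(i := k i + 1)) x + ?c' i * ?G (k(i := k i - 1)) x)"
      unfolding * distrib_left sum_distrib_left by (simp add: algebra_simps)
    finally show ?thesis .
  qed
  then have "(\<integral>x. h x * char d k x * of_real (p x ^ Suc N) \<partial>torus_measure d) =
      (\<integral>x. of_real a * ?G k x +
      (\<Sum>i<d. ?c i * ?G (k(i := k i + 1)) x + ?c' i * ?G (k(i := k i - 1)) x) \<partial>torus_measure d)"
    by presburger
  also have "\<dots> = of_real a * integral\<^sup>L (torus_measure d) (?G k) +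
      (\<Sum>i<d. ?c i * integral\<^sup>L (torus_measure d) (?G (k(i := k i + 1))) +
        ?c' i * integral\<^sup>L (torus_measure d) (?G (k(i := k i - 1))))"
    by (simp only: Bochner_Integration.integral_add Bochner_Integration.integral_sum integral_mult_right_zero
      integrable_mult_right integrable_add integrable_sum int Bochner_Integration.integrable_add
      Bochner_Integration.integrable_sum)
  also have "\<dots> = 0"
    using Suc.IH[OF Suc.prems] Suc.IH[OF Zd_upd[OF Suc.prems]]
    by (simp del: of_real_power fun_upd_apply)
  finally show ?case .
qed

text \<open>Powers of the trigonometric polynomial p concentrate at y, so a continuous function that is
  orthogonal to all of them and does not vanish at y leads to a contradiction.\<close>

lemma fourier_unique_interior:
  fixes h :: tfun
  assumes h: "torus_cont d h" and 0: "\<And>k. k \<in> Zd d \<Longrightarrow> fourier d h k = 0"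
    and y: "y \<in> cube d" "\<And>i. i < d \<Longrightarrow> 0 < y i \<and> y i < 1"
  shows "h y = 0"
proof (rule ccontr)
  assume neg: "h y \<noteq> 0"
  have ch: "continuous_on (Rd d) h" using h by (rule torus_cont_continuous)
  have yR: "y \<in> Rd d" using y(1) cube_subset_Rd by blast
  \<comment> \<open>Projecting on the direction of \<open>h y\<close> gives a real function with
    \<open>H y = 2 * c\<close> and c > 0, so that \<open>H\<close> stays above c near y.\<close>
  define H where "H = (\<lambda>x. Re (h x * cnj (h y)))"
  define c where "c = (cmod (h y))\<^sup>2 / 2"
  have "c > 0" using neg by (simp add: c_def)
  have Hy: "H y = 2 * c" by (simp add: H_def c_def cmod_power2) (simp add: power2_eq_square)
  have cH: "continuous_on (Rd d) H" unfolding H_def by (intro continuous_intros ch)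
  obtain M where M: "M \<ge> 0" "\<And>x. x \<in> cube d \<Longrightarrow> \<bar>H x\<bar> \<le> M"
    using bounded_on_cube[OF cH] by (metis real_norm_def)
  obtain \<delta>0 where \<delta>0: "\<delta>0 > 0"
    "\<And>x. x \<in> Rd d \<Longrightarrow> (\<And>i. i < d \<Longrightarrow> \<bar>x i - y i\<bar> < \<delta>0) \<Longrightarrow> dist (H x) (H y) < c"
    using continuous_on_Rd_box[OF cH yR \<open>c > 0\<close>] by metis
  \<comment> \<open>\<open>\<delta>\<close> must keep \<open>H\<close> above c, make cos (2 \<pi>
    \<delta>) nonnegative, and not exceed the distance from y to any face: only then does |x i - y
    i| \<ge> \<delta> in the cube imply |x i - y i| \<le> 1 - \<delta>, where the periodic cosine is
    away from its next peak.\<close>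
  define D where "D = insert \<delta>0 (insert (1/4) (y ` {..<d} \<union> (\<lambda>i. 1 - y i) ` {..<d}))"
  define \<delta> where "\<delta> = Min D"
  have "finite D" "D \<noteq> {}" by (auto simp: D_def)
  moreover have "\<forall>r\<in>D. 0 < r" using \<delta>0(1) y(2) by (auto simp: D_def)
  ultimately have "\<delta> > 0" by (simp add: \<delta>_def)
  moreover have "\<delta> \<le> r" if "r \<in> D" for r
    unfolding \<delta>_def using \<open>finite D\<close> that by (rule Min_le)
  ultimately have \<delta>: "\<delta> > 0" "\<delta> \<le> \<delta>0" "\<delta> \<le> 1/4"
      "\<And>i. i < d \<Longrightarrow> \<delta> \<le> y i" "\<And>i. i < d \<Longrightarrow> \<delta> \<le> 1 - y i"
    unfolding D_def by blast+
  \<comment> \<open>The shift d + 1 makes p nonnegative, so bounds on p carry over to its powers.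
    The maximum 2 d + 1 is taken at y; off the \<delta>-box one cosine is at most cos (2 \<pi>
    \<delta>), which gives B.\<close>
  define p where "p = (\<lambda>x. real (d + 1) + (\<Sum>i<d. cos (2 * pi * (x i - y i))))"
  define B where "B = 2 * real d + cos (2 * pi * \<delta>)"
  have cp: "continuous_on (Rd d) p" unfolding p_def by (intro continuous_intros)
  have py: "p y = 2 * real d + 1" by (simp add: p_def)
  have "cos (2 * pi * \<delta>) < cos 0"
    using \<delta>(1,3) by (intro cos_monotone_0_pi) auto
  then have "B < p y" by (simp add: py B_def)
  have p_nonneg: "p x \<ge> 0" for x
  proof -
    have "(\<Sum>i<d. cos (2 * pi * (x i - y i))) \<ge> (\<Sum>i<d. - 1)" by (intro sum_mono) auto
    then show ?thesis by (simp add: p_def)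
  qed
  have "0 \<le> 2 * pi * \<delta>" "2 * pi * \<delta> \<le> pi / 2"
    using \<delta>(1,3) mult_left_mono[of \<delta> "1/4" "2 * pi"] by auto
  then have "cos (2 * pi * \<delta>) \<ge> 0" by (intro cos_ge_zero) (use pi_gt_zero in linarith)+
  then have "B \<ge> 0" by (simp add: B_def)
  have p_out: "p x \<le> B" if x: "x \<in> cube d" "i < d" "\<not> \<bar>x i - y i\<bar> < \<delta>" for x i
  proof -
    have xi: "0 \<le> x i" "x i \<le> 1" using x by (auto simp: cube_def PiE_iff)
    define t where "t = \<bar>x i - y i\<bar>"
    have t: "\<delta> \<le> t" "t \<le> 1 - \<delta>" using x xi \<delta>(4,5)[of i] by (auto simp: t_def)
    have "cos (2 * pi * t) \<le> cos (2 * pi * \<delta>)"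
    proof (cases "t \<le> 1/2")
      case True
      then show ?thesis using t \<delta> by (intro cos_monotone_0_pi_le) auto
    next
      case False
      have "cos (2 * pi * t) = cos (2 * pi * (1 - t))"
        by (simp add: right_diff_distrib cos_diff)
      also have "\<dots> \<le> cos (2 * pi * \<delta>)"
        using False t \<delta> by (intro cos_monotone_0_pi_le) auto
      finally show ?thesis .
    qed
    moreover have "cos (2 * pi * (x i - y i)) = cos (2 * pi * t)"
      using cos_minus[of "2 * pi * (x i - y i)"] by (simp add: t_def abs_if algebra_simps)
    ultimately have *: "cos (2 * pi * (x i - y i)) \<le> cos (2 * pi * \<delta>)" by simp
    have "(\<Sum>j<d. cos (2 * pi * (x j - y j))) =
        cos (2 * pi * (x i - y i)) + (\<Sum>j\<in>{..<d} - {i}. cos (2 * pi * (x j - y j)))"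
      using x(2) by (subst sum.remove[of _ i]) auto
    also have "(\<Sum>j\<in>{..<d} - {i}. cos (2 * pi * (x j - y j))) \<le> (\<Sum>j\<in>{..<d} - {i}. 1)"
      by (intro sum_mono) auto
    also have "(\<Sum>j\<in>{..<d} - {i}. 1) = real d - 1"
      using x(2) by (simp add: of_nat_diff)
    finally show ?thesis using * by (simp add: p_def B_def)
  qed
  \<comment> \<open>Any level strictly between the bound off the box and the peak would do; p is at
    least B' on the smaller box \<open>b\<close>, and this growth rate beats B.\<close>
  define B' where "B' = (B + p y) / 2"
  have B': "B < B'" "B' > 0" using \<open>B < p y\<close> \<open>B \<ge> 0\<close> by (auto simp: B'_def)
  obtain \<delta>1 where \<delta>1: "\<delta>1 > 0"
    "\<And>x. x \<in> Rd d \<Longrightarrow> (\<And>i. i < d \<Longrightarrow> \<bar>x i - y i\<bar> < \<delta>1) \<Longrightarrow> dist (p x) (p y) < p y - B'"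
    using continuous_on_Rd_box[OF cp yR, of "p y - B'"] \<open>B < p y\<close> unfolding B'_def by (auto simp: field_simps)
  define b where "b = cube_nbhd d y (min \<delta> \<delta>1)"
  define \<mu> where "\<mu> = measure (torus_measure d) b"
  interpret finite_measure "torus_measure d" by (rule finite_measure_torus)
  have "\<mu> > 0"
    using emeasure_cube_nbhd_pos[OF y(1), of "min \<delta> \<delta>1"] \<delta>(1) \<delta>1(1)
    by (simp add: \<mu>_def b_def emeasure_eq_measure zero_less_measure_iff)
  have pw: "c * B' ^ N * indicator b x - M * B ^ N \<le> H x * p x ^ N" if x: "x \<in> cube d" for x N
  proof (cases "\<forall>i<d. \<bar>x i - y i\<bar> < \<delta>")
    case True
    then have "dist (H x) (H y) < c" using \<delta>0(2)[of x] \<delta>(2) x cube_subset_Rd by force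
    then have Hx: "H x \<ge> c" using Hy by (auto simp: dist_real_def)
    have "c * B' ^ N * indicator b x \<le> H x * p x ^ N"
    proof (cases "x \<in> b")
      case True
      then have "dist (p x) (p y) < p y - B'"
        using cube_nbhd_dist[of x d y "min \<delta> \<delta>1"] x cube_subset_Rd by (intro \<delta>1(2)) (auto simp: b_def)
      then have "B' \<le> p x" by (auto simp: dist_real_def)
      then have "c * B' ^ N \<le> H x * p x ^ N"
        using Hx \<open>c > 0\<close> B' by (intro mult_mono power_mono) auto
      then show ?thesis using True by simp
    next
      case False
      then show ?thesis using Hx \<open>c > 0\<close> p_nonneg[of x] by simp
    qed
    moreover have "M * B ^ N \<ge> 0" using M(1) \<open>B \<ge> 0\<close> by simp
    ultimately show ?thesis by linarith
  next
    case False
    then obtain i where i: "i < d" "\<not> \<bar>x i - y i\<bar> < \<delta>" by auto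
    then have "x \<notin> b" using cube_nbhd_dist[of x d y "min \<delta> \<delta>1" i] by (auto simp: b_def)
    moreover have "\<bar>H x * p x ^ N\<bar> \<le> M * B ^ N"
      unfolding abs_mult power_abs using M p_nonneg[of x] p_out[OF x i] x
      by (intro mult_mono power_mono) auto
    ultimately show ?thesis by simp
  qed
  have bound: "c * B' ^ N * \<mu> \<le> M * B ^ N" for N
  proof -
    define k0 where "k0 = restrict (\<lambda>_. 0 :: int) {..<d}"
    have "k0 \<in> Zd d" by (simp add: k0_def Zd_def)
    have k0: "char d k0 x = 1" for x by (simp add: char_def k0_def)
    have ci: "integrable (torus_measure d) (\<lambda>x. h x * of_real (p x ^ N))"
      by (intro integrable_torus_continuous continuous_intros ch cp)
    have "(\<integral>x. h x * of_real (p x ^ N) \<partial>torus_measure d) = 0"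
      using integral_peak_power_eq_0[OF h 0 p_def \<open>k0 \<in> Zd d\<close>, of N] by (simp add: k0)
    then have "(\<integral>x. cnj (h y) * (h x * of_real (p x ^ N)) \<partial>torus_measure d) = 0"
      by simp
    moreover have "(\<integral>x. Re (cnj (h y) * (h x * of_real (p x ^ N))) \<partial>torus_measure d) =
        Re (\<integral>x. cnj (h y) * (h x * of_real (p x ^ N)) \<partial>torus_measure d)"
      by (intro integral_Re integrable_mult_right ci)
    moreover have "Re (cnj (h y) * (h x * of_real (p x ^ N))) = H x * p x ^ N" for x
    proof -
      have "cnj (h y) * (h x * of_real (p x ^ N)) = (p x ^ N) *\<^sub>R (h x * cnj (h y))"
        by (simp add: scaleR_conv_of_real mult_ac)
      then show ?thesis by (simp only: H_def scaleR_complex.sel mult.commute)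
    qed
    ultimately have "0 = (\<integral>x. H x * p x ^ N \<partial>torus_measure d)" by (simp only: zero_complex.sel)
    also have "\<dots> \<ge> (\<integral>x. c * B' ^ N * indicator b x - M * B ^ N \<partial>torus_measure d)"
    proof (rule integral_mono)
      show "integrable (torus_measure d) (\<lambda>x. c * B' ^ N * indicator b x - M * B ^ N)"
        using cube_nbhd_in_sets[of d y "min \<delta> \<delta>1"] by (simp add: b_def emeasure_eq_measure)
      show "integrable (torus_measure d) (\<lambda>x. H x * p x ^ N)"
        by (intro integrable_torus_continuous continuous_intros cH cp)
    qed (use pw in simp)
    also have "(\<integral>x. c * B' ^ N * indicator b x - M * B ^ N \<partial>torus_measure d) = c * B' ^ N * \<mu> - M * B ^ N"
      using cube_nbhd_in_sets[of d y "min \<delta> \<delta>1"] Int_absorb2[OF cube_nbhd_subset[of d y "min \<delta> \<delta>1"]]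
      by (subst Bochner_Integration.integral_diff) (auto simp: b_def \<mu>_def emeasure_eq_measure)
    finally show ?thesis by simp
  qed
  \<comment> \<open>Dividing by B'^N and letting N grow leaves c \<mu> \<le> 0.\<close>
  have "(\<lambda>N. M * (B / B') ^ N) \<longlonglongrightarrow> M * 0"
    using B' \<open>B \<ge> 0\<close> by (intro tendsto_intros LIMSEQ_power_zero) auto
  moreover have "c * \<mu> \<le> M * (B / B') ^ N" for N
    using bound[of N] B' by (simp add: power_divide field_simps)
  ultimately have "c * \<mu> \<le> M * 0"
    by (intro LIMSEQ_le_const) auto
  then show False using \<open>c > 0\<close> \<open>\<mu> > 0\<close> by (simp add: mult_le_0_iff)
qed

text \<open>For a point on a face the peak of p reappears on the opposite face, so boundary points
  are reached by continuity: clamping the coordinates of \<open>x\<close> to [e, 1 - e] gives a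
  nearby interior point, where h vanishes.\<close>

lemma fourier_unique_cube:
  fixes h :: tfun
  assumes h: "torus_cont d h" and 0: "\<And>k. k \<in> Zd d \<Longrightarrow> fourier d h k = 0" and x: "x \<in> cube d"
  shows "h x = 0"
proof (rule ccontr)
  assume neg: "h x \<noteq> 0"
  obtain \<delta> where \<delta>: "\<delta> > 0"
    "\<And>y. y \<in> Rd d \<Longrightarrow> (\<And>i. i < d \<Longrightarrow> \<bar>y i - x i\<bar> < \<delta>) \<Longrightarrow> dist (h y) (h x) < cmod (h x)"
    using continuous_on_Rd_box[OF torus_cont_continuous[OF h] subsetD[OF cube_subset_Rd x], of "cmod (h x)"] neg
    by auto
  define e where "e = min (1/4) (\<delta> / 2)"
  have e: "0 < e" "e < \<delta>" "e \<le> 1/4" using \<delta>(1) by (auto simp: e_def)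
  define y where "y = restrict (\<lambda>i. max e (min (1 - e) (x i))) {..<d}"
  have xi: "0 \<le> x i" "x i \<le> 1" if "i < d" for i using x that by (auto simp: cube_def PiE_iff)
  have y: "y \<in> cube d" using e by (auto simp: y_def cube_def PiE_iff)
  have "dist (h y) (h x) < cmod (h x)"
  proof (rule \<delta>(2))
    show "y \<in> Rd d" using y cube_subset_Rd by blast
    show "\<bar>y i - x i\<bar> < \<delta>" if "i < d" for i
      using e xi[OF that] that by (auto simp: y_def abs_less_iff max_def min_def)
  qed
  moreover have "h y = 0"
    by (rule fourier_unique_interior[OF h 0 y]) (use e in \<open>auto simp: y_def\<close>)
  ultimately show False by simp
qed

text \<open>The absolutely convergent series defines a continuous periodic F; its coefficients are
  those of f by uniform convergence, and uniqueness applies to f - F.\<close>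

lemma fourier_series_eq:
  fixes f :: tfun
  assumes f: "torus_cont d f" and summ: "(\<lambda>k. cmod (fourier d f k)) summable_on Zd d"
    and x: "x \<in> cube d"
  shows "((\<lambda>k. fourier d f k * char d k x) has_sum f x) (Zd d)"
proof -
  define F where "F = (\<lambda>x. \<Sum>\<^sub>\<infinity>k\<in>Zd d. fourier d f k * char d k x)"
  define S where "S = (\<lambda>J x. \<Sum>k\<in>J. fourier d f k * char d k x)"
  have sm: "(\<lambda>k. fourier d f k * char d k x) summable_on Zd d" for x
    by (rule abs_summable_summable) (use summ in \<open>simp add: norm_mult\<close>)
  have ul: "uniform_limit UNIV S F (finite_subsets_at_top (Zd d))"
    unfolding S_def F_def
    by (rule Weierstrass_m_test_general[OF _ summ]) (simp add: norm_mult)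
  have "continuous_on UNIV F"
    by (rule uniform_limit_theorem[OF _ ul]) (auto simp: S_def intro!: continuous_intros always_eventually)
  then have F: "torus_cont d F"
    unfolding torus_cont_def by (auto simp: F_def char_periodic intro: continuous_on_subset)
  have "fourier d F l = fourier d f l" if l: "l \<in> Zd d" for l
  proof -
    have "dist (fourier d F l) (fourier d f l) \<le> 0 + e" if "e > 0" for e
    proof -
      have "eventually (\<lambda>J. \<forall>x\<in>UNIV. dist (S J x) (F x) < e) (finite_subsets_at_top (Zd d))"
        using ul \<open>e > 0\<close> by (rule uniform_limitD)
      moreover have "eventually (\<lambda>J. finite J \<and> J \<subseteq> Zd d \<and> {l} \<subseteq> J) (finite_subsets_at_top (Zd d))"
        using l by (auto simp: eventually_finite_subsets_at_top intro!: exI[of _ "{l}"])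
      ultimately have "eventually (\<lambda>J. (\<forall>x\<in>UNIV. dist (S J x) (F x) < e) \<and> finite J \<and> J \<subseteq> Zd d \<and> {l} \<subseteq> J)
          (finite_subsets_at_top (Zd d))"
        by (rule eventually_conj)
      from eventually_happens'[OF _ this] obtain J
        where J: "\<And>x. dist (S J x) (F x) < e" "finite J" "J \<subseteq> Zd d" "l \<in> J"
        by auto
      have SJ: "torus_cont d (S J)" unfolding S_def using J(2) by (rule torus_cont_trig)
      have "fourier d F l - fourier d (S J) l = (\<integral>x. (F x - S J x) * cnj (char d l x) \<partial>torus_measure d)"
        unfolding fourier_diff[OF F SJ, symmetric] by (rule fourier_eq)
      also have "cmod \<dots> \<le> e"
        using J(1)
        by (intro norm_integral_torus_le borel_measurable_torus continuous_intros torus_cont_continuous F SJ)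
           (simp add: norm_mult dist_norm norm_minus_commute less_imp_le)
      finally have "cmod (fourier d F l - fourier d (S J) l) \<le> e" .
      moreover have "fourier d (S J) l = fourier d f l"
        unfolding S_def using J l by (subst fourier_trig) auto
      ultimately show ?thesis by (simp add: dist_norm)
    qed
    then have "dist (fourier d F l) (fourier d f l) \<le> 0" by (rule field_le_epsilon)
    then show ?thesis by simp
  qed
  then have "f x = F x"
    using fourier_unique_cube[of d "\<lambda>x. f x - F x" x] x by (simp add: fourier_diff torus_cont_diff f F)
  then show ?thesis using sm[of x] by (simp add: F_def has_sum_infsum)
qed

lemma norm_le_infsum_fourier:
  assumes "torus_cont d f" "(\<lambda>k. cmod (fourier d f k)) summable_on Zd d" "x \<in> cube d"
  shows "cmod (f x) \<le> (\<Sum>\<^sub>\<infinity>k\<in>Zd d. cmod (fourier d f k))"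
proof -
  have "f x = (\<Sum>\<^sub>\<infinity>k\<in>Zd d. fourier d f k * char d k x)"
    using fourier_series_eq[OF assms] by (simp add: infsumI)
  also have "cmod \<dots> \<le> (\<Sum>\<^sub>\<infinity>k\<in>Zd d. cmod (fourier d f k * char d k x))"
    by (rule norm_infsum_bound) (use assms in \<open>simp add: norm_mult\<close>)
  finally show ?thesis by (simp add: norm_mult)
qed

lemma Linf_norm_le:
  assumes "continuous_on (Rd d) f" "\<And>x. x \<in> cube d \<Longrightarrow> cmod (f x) \<le> E"
  shows "Linf_norm d f \<le> ereal E"
  unfolding Linf_norm_def
proof (rule esssup_I)
  show "(\<lambda>x. ereal (cmod (f x))) \<in> borel_measurable (torus_measure d)"
    using borel_measurable_torus[OF assms(1)] by measurable
  show "AE x in torus_measure d. ereal (cmod (f x)) \<le> ereal E"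
    using assms(2) by (intro AE_I2) auto
qed

lemma Linf_norm_nonneg: "Linf_norm d f \<ge> 0"
proof -
  have "esssup (torus_measure d) (\<lambda>_. 0 :: ereal) \<le> Linf_norm d f"
    unfolding Linf_norm_def by (intro esssup_mono) auto
  then show ?thesis by (simp add: esssup_const emeasure_torus_cube)
qed

section \<open>The weighted Hilbert space and its embedding into the bounded functions\<close>

locale weighted_space =
  fixes \<omega> :: "nat \<Rightarrow> (nat \<Rightarrow> int) \<Rightarrow> real" and d :: nat
  assumes weight_pos: "\<And>k. k \<in> Zd d \<Longrightarrow> \<omega> d k > 0"
    and weight_summable: "(\<lambda>k. 1 / (\<omega> d k)\<^sup>2) summable_on Zd d"
begin

text \<open>T(I) of the overview: the squared worst uniform norm in the unit ball among functions
  whose coefficients with k in I vanish.\<close>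

definition tail :: "(nat \<Rightarrow> int) set \<Rightarrow> real" where
  "tail I = (\<Sum>\<^sub>\<infinity>k\<in>Zd d - I. 1 / (\<omega> d k)\<^sup>2)"

lemma tail_nonneg: "tail I \<ge> 0"
  unfolding tail_def by (intro infsum_nonneg) auto

lemma Hsp_torus_cont: "f \<in> Hsp \<omega> d \<Longrightarrow> torus_cont d f"
  by (simp add: Hsp_def)

lemma Hnorm_nonneg: "Hnorm \<omega> d f \<ge> 0"
  unfolding Hnorm_def by (intro real_sqrt_ge_zero infsum_nonneg) auto

text \<open>Cauchy-Schwarz with the factors |f^(k)| \<omega>(k) and 1 / \<omega>(k), on finite sets
  of frequencies; boundedness of the finite sums also yields summability. With I = {} it bounds the
  sup norm.\<close>

lemma fourier_tail:
  assumes f: "f \<in> Hsp \<omega> d"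
  shows "(\<lambda>k. cmod (fourier d f k)) summable_on Zd d - I"
    and "(\<Sum>\<^sub>\<infinity>k\<in>Zd d - I. cmod (fourier d f k)) \<le> Hnorm \<omega> d f * sqrt (tail I)"
proof -
  have *: "(\<Sum>k\<in>J. cmod (fourier d f k)) \<le> Hnorm \<omega> d f * sqrt (tail I)"
    if J: "finite J" "J \<subseteq> Zd d - I" for J
  proof -
    have "(\<Sum>k\<in>J. cmod (fourier d f k)) = (\<Sum>k\<in>J. \<bar>cmod (fourier d f k) * \<omega> d k\<bar> * \<bar>1 / \<omega> d k\<bar>)"
      using J weight_pos by (intro sum.cong refl) (force simp: abs_mult)
    also have "\<dots> \<le> L2_set (\<lambda>k. cmod (fourier d f k) * \<omega> d k) J * L2_set (\<lambda>k. 1 / \<omega> d k) J"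
      by (rule L2_set_mult_ineq)
    also have "\<dots> \<le> Hnorm \<omega> d f * sqrt (tail I)"
    proof (intro mult_mono)
      show "L2_set (\<lambda>k. cmod (fourier d f k) * \<omega> d k) J \<le> Hnorm \<omega> d f"
        unfolding L2_set_def Hnorm_def power_mult_distrib
        using f J by (intro real_sqrt_le_mono finite_sum_le_infsum) (auto simp: Hsp_def)
      show "L2_set (\<lambda>k. 1 / \<omega> d k) J \<le> sqrt (tail I)"
        unfolding L2_set_def tail_def power_divide power_one using J
        by (intro real_sqrt_le_mono finite_sum_le_infsum summable_on_subset_banach[OF weight_summable]) auto
    qed (auto simp: Hnorm_nonneg L2_set_nonneg)
    finally show ?thesis .
  qed
  show s: "(\<lambda>k. cmod (fourier d f k)) summable_on Zd d - I"
    by (intro nonneg_bdd_above_summable_on bdd_aboveI2[where M = "Hnorm \<omega> d f * sqrt (tail I)"]) (use * in auto)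
  show "(\<Sum>\<^sub>\<infinity>k\<in>Zd d - I. cmod (fourier d f k)) \<le> Hnorm \<omega> d f * sqrt (tail I)"
    by (rule infsum_le_finite_sums[OF s]) (use * in auto)
qed

lemmas fourier_summable = fourier_tail(1)[where I = "{}", simplified]

lemma Hsp_norm_le:
  assumes "f \<in> Hsp \<omega> d" "x \<in> cube d"
  shows "cmod (f x) \<le> Hnorm \<omega> d f * sqrt (tail {})"
  using norm_le_infsum_fourier[OF Hsp_torus_cont[OF assms(1)] fourier_summable[OF assms(1)] assms(2)]
    fourier_tail(2)[OF assms(1), of "{}"] by simp

lemma trig_in_Hsp:
  assumes "finite J" "J \<subseteq> Zd d"
  shows "(\<lambda>x. \<Sum>k\<in>J. c k * char d k x) \<in> Hsp \<omega> d"
    and "Hnorm \<omega> d (\<lambda>x. \<Sum>k\<in>J. c k * char d k x) = sqrt (\<Sum>k\<in>J. (cmod (c k) * \<omega> d k)\<^sup>2)"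
proof -
  let ?g = "\<lambda>k. (cmod (fourier d (\<lambda>x. \<Sum>k\<in>J. c k * char d k x) k))\<^sup>2 * (\<omega> d k)\<^sup>2"
  have g: "?g k = (if k \<in> J then (cmod (c k) * \<omega> d k)\<^sup>2 else 0)" if "k \<in> Zd d" for k
    using fourier_trig[OF assms that, of c] by (simp add: power_mult_distrib)
  have "(?g has_sum (\<Sum>k\<in>J. ?g k)) J" using assms(1) by (rule has_sum_finite)
  then have "(?g has_sum (\<Sum>k\<in>J. ?g k)) (Zd d)"
    by (rule has_sum_cong_neutral[THEN iffD1, rotated -1]) (use assms g in auto)
  moreover have "(\<Sum>k\<in>J. ?g k) = (\<Sum>k\<in>J. (cmod (c k) * \<omega> d k)\<^sup>2)"
    using assms by (intro sum.cong refl, subst g) auto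
  ultimately have hs: "(?g has_sum (\<Sum>k\<in>J. (cmod (c k) * \<omega> d k)\<^sup>2)) (Zd d)" by simp
  then show "(\<lambda>x. \<Sum>k\<in>J. c k * char d k x) \<in> Hsp \<omega> d"
    unfolding Hsp_def using torus_cont_trig[OF assms(1)] by (auto simp: has_sum_imp_summable)
  show "Hnorm \<omega> d (\<lambda>x. \<Sum>k\<in>J. c k * char d k x) = sqrt (\<Sum>k\<in>J. (cmod (c k) * \<omega> d k)\<^sup>2)"
    unfolding Hnorm_def using infsumI[OF hs] by simp
qed

lemma zero_in_Hball: "(\<lambda>x. 0) \<in> Hball \<omega> d"
  using trig_in_Hsp[of "{}"] by (simp add: Hball_def)

lemma Lstd_subset_Lall: "Lstd d \<subseteq> Lall \<omega> d"
  unfolding Lstd_def Lall_def using Hsp_norm_le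
  by (auto intro!: exI[of _ "sqrt (tail {})"] simp: mult.commute)

text \<open>Finiteness makes the normalised threshold an ordinary real number, so that \<epsilon>
  and \<epsilon> / 10 can be compared without cases for infinity.\<close>

lemma err0_real: "\<exists>r\<ge>0. err0 \<omega> d = ereal r"
proof -
  have "err0 \<omega> d \<le> ereal (sqrt (tail {}))"
    unfolding err0_def
  proof (rule SUP_least)
    fix f assume f: "f \<in> Hball \<omega> d"
    then have "cmod (f x) \<le> sqrt (tail {})" if "x \<in> cube d" for x
      using Hsp_norm_le[of f x] that mult_right_mono[of "Hnorm \<omega> d f" 1 "sqrt (tail {})"]
      by (auto simp: Hball_def tail_nonneg)
    then show "Linf_norm d f \<le> ereal (sqrt (tail {}))"
      using f by (intro Linf_norm_le torus_cont_continuous Hsp_torus_cont) (auto simp: Hball_def)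
  qed
  moreover have "err0 \<omega> d \<ge> 0"
    unfolding err0_def using zero_in_Hball Linf_norm_nonneg by (rule SUP_upper2)
  ultimately show ?thesis
    by (cases "err0 \<omega> d") auto
qed

lemma CRI_real: "\<exists>r\<ge>0. CRI \<omega> c d = ereal r"
  using err0_real by (cases c) (auto simp: CRI_def one_ereal_def intro: exI[of _ 1])

end

section \<open>Orthogonal projections in finite dimension\<close>

text \<open>Vectors are total functions that are read only on the coordinate set
  \<open>J\<close>.\<close>

definition ip :: "'a set \<Rightarrow> ('a \<Rightarrow> complex) \<Rightarrow> ('a \<Rightarrow> complex) \<Rightarrow> complex" where
  "ip J u v = (\<Sum>k\<in>J. u k * cnj (v k))"

definition proj_compl :: "'a set \<Rightarrow> ('a \<Rightarrow> complex) set \<Rightarrow> ('a \<Rightarrow> complex) \<Rightarrow> 'a \<Rightarrow> complex" where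
  "proj_compl J Q w = (\<lambda>k. w k - (\<Sum>q\<in>Q. ip J w q * q k))"

definition orthonormal_in :: "'a set \<Rightarrow> ('a \<Rightarrow> complex) set \<Rightarrow> bool" where
  "orthonormal_in J Q \<longleftrightarrow> finite Q \<and> (\<forall>p\<in>Q. \<forall>q\<in>Q. ip J p q = (if p = q then 1 else 0))"

lemma cnj_ip: "cnj (ip J u v) = ip J v u"
  by (simp add: ip_def mult.commute)

lemma ip_self: "ip J u u = of_real (\<Sum>k\<in>J. (cmod (u k))\<^sup>2)"
  by (simp add: ip_def complex_norm_square del: of_real_power)

lemma ip_scale_left: "ip J (\<lambda>k. c * u k) v = c * ip J u v"
  by (simp add: ip_def sum_distrib_left mult.assoc)

lemma ip_scale_right: "ip J u (\<lambda>k. c * v k) = cnj c * ip J u v"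
  by (simp add: ip_def sum_distrib_left mult_ac)

lemma ip_proj_compl_left:
  "ip J (proj_compl J Q w) v = ip J w v - (\<Sum>q\<in>Q. ip J w q * ip J q v)"
proof -
  have "ip J (proj_compl J Q w) v = ip J w v - (\<Sum>k\<in>J. \<Sum>q\<in>Q. ip J w q * (q k * cnj (v k)))"
    by (simp add: proj_compl_def ip_def[of J _ v] left_diff_distrib sum_subtractf sum_distrib_right mult.assoc)
  also have "(\<Sum>k\<in>J. \<Sum>q\<in>Q. ip J w q * (q k * cnj (v k))) = (\<Sum>q\<in>Q. ip J w q * ip J q v)"
    by (subst sum.swap) (simp add: ip_def[of J _ v] sum_distrib_left)
  finally show ?thesis .
qed

lemma ip_proj_compl_right:
  "ip J v (proj_compl J Q w) = ip J v w - (\<Sum>q\<in>Q. ip J q w * ip J v q)"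
  using arg_cong[OF ip_proj_compl_left[of J Q w v], of cnj] by (simp add: cnj_ip)

lemma proj_compl_orthogonal:
  assumes "orthonormal_in J Q" "q \<in> Q"
  shows "ip J (proj_compl J Q w) q = 0"
proof -
  have "(\<Sum>p\<in>Q. ip J w p * ip J p q) = (\<Sum>p\<in>Q. if p = q then ip J w p else 0)"
    using assms by (intro sum.cong) (auto simp: orthonormal_in_def)
  also have "\<dots> = ip J w q" using assms by (simp add: orthonormal_in_def)
  finally show ?thesis by (simp add: ip_proj_compl_left)
qed

lemma ip_proj_compl_self:
  assumes "orthonormal_in J Q"
  shows "ip J (proj_compl J Q w) (proj_compl J Q w) = ip J (proj_compl J Q w) w"
    and "(\<Sum>k\<in>J. (cmod (proj_compl J Q w k))\<^sup>2) = (\<Sum>k\<in>J. (cmod (w k))\<^sup>2) - (\<Sum>q\<in>Q. (cmod (ip J w q))\<^sup>2)"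
proof -
  show *: "ip J (proj_compl J Q w) (proj_compl J Q w) = ip J (proj_compl J Q w) w"
    using proj_compl_orthogonal[OF assms] by (simp add: ip_proj_compl_right)
  have "ip J (proj_compl J Q w) w = ip J w w - (\<Sum>q\<in>Q. ip J w q * cnj (ip J w q))"
    by (simp add: ip_proj_compl_left cnj_ip)
  then have "of_real (\<Sum>k\<in>J. (cmod (proj_compl J Q w k))\<^sup>2) =
      (of_real ((\<Sum>k\<in>J. (cmod (w k))\<^sup>2) - (\<Sum>q\<in>Q. (cmod (ip J w q))\<^sup>2)) :: complex)"
    using * by (simp add: ip_self complex_norm_square del: of_real_power)
  then show "(\<Sum>k\<in>J. (cmod (proj_compl J Q w k))\<^sup>2) = (\<Sum>k\<in>J. (cmod (w k))\<^sup>2) - (\<Sum>q\<in>Q. (cmod (ip J w q))\<^sup>2)"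
    by (simp only: of_real_eq_iff)
qed

text \<open>Bessel's inequality for the k-th unit vector. The sum is the k-th diagonal entry of the
  orthogonal projection onto the span of \<open>Q\<close>.\<close>

lemma orthonormal_weights_le_1:
  assumes "orthonormal_in J Q" "finite J" "k \<in> J"
  shows "(\<Sum>q\<in>Q. (cmod (q k))\<^sup>2) \<le> 1"
proof -
  let ?w = "\<lambda>l. if l = k then 1 else 0 :: complex"
  have "ip J ?w q = cnj (q k)" for q
  proof -
    have "ip J ?w q = (\<Sum>l\<in>J. if l = k then cnj (q l) else 0)"
      unfolding ip_def by (intro sum.cong) auto
    then show ?thesis using assms by simp
  qed
  moreover have "(\<Sum>l\<in>J. (cmod (?w l))\<^sup>2) = 1"
  proof -
    have "(\<Sum>l\<in>J. (cmod (?w l))\<^sup>2) = (\<Sum>l\<in>J. if l = k then 1 else 0)"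
      by (intro sum.cong) auto
    then show ?thesis using assms by simp
  qed
  moreover have "0 \<le> (\<Sum>l\<in>J. (cmod (proj_compl J Q ?w l))\<^sup>2)" by (intro sum_nonneg) auto
  ultimately show ?thesis using ip_proj_compl_self(2)[OF assms(1), of ?w] by simp
qed

text \<open>The lower bound uses orthogonal complements, so the span of \<open>as\<close> enters
  through the implication on v. A vector dependent on the previous ones leaves a remainder that
  vanishes on \<open>J\<close> and is dropped, hence the inequality for
  \<open>card Q\<close>.\<close>

lemma gram_schmidt:
  fixes as :: "('a \<Rightarrow> complex) list"
  assumes "finite J"
  shows "\<exists>Q. orthonormal_in J Q \<and> card Q \<le> length as \<and>
    (\<forall>v. (\<forall>q\<in>Q. ip J v q = 0) \<longrightarrow> (\<forall>a\<in>set as. ip J v a = 0))"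
proof (induction as)
  case Nil
  show ?case by (intro exI[of _ "{}"]) (simp add: orthonormal_in_def)
next
  case (Cons a as)
  then obtain Q where Q: "orthonormal_in J Q" "card Q \<le> length as"
    "\<And>v a. (\<forall>q\<in>Q. ip J v q = 0) \<Longrightarrow> a \<in> set as \<Longrightarrow> ip J v a = 0"
    by blast
  define b where "b = proj_compl J Q a"
  have b: "ip J v a = ip J v b" if "\<forall>q\<in>Q. ip J v q = 0" for v
    using that by (simp add: b_def ip_proj_compl_right)
  show ?case
  proof (cases "ip J b b = 0")
    case True
    then have "(\<Sum>k\<in>J. (cmod (b k))\<^sup>2) = 0" unfolding ip_self of_real_eq_0_iff .
    then have "b k = 0" if "k \<in> J" for k
      using that assms by (simp add: sum_nonneg_eq_0_iff)
    then have "ip J v b = 0" for v by (simp add: ip_def)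
    then show ?thesis using Q b by (intro exI[of _ Q]) (auto intro: le_SucI)
  next
    case False
    define r where "r = sqrt (\<Sum>k\<in>J. (cmod (b k))\<^sup>2)"
    have r2: "ip J b b = of_real (r\<^sup>2)"
      unfolding ip_self r_def by (subst real_sqrt_pow2) (auto intro: sum_nonneg)
    then have "r \<noteq> 0" using False by auto
    define e where "e = (\<lambda>k. of_real (1 / r) * b k)"
    have e1: "ip J e e = 1"
      unfolding e_def ip_scale_left ip_scale_right r2 using \<open>r \<noteq> 0\<close>
      by (simp add: power2_eq_square)
    have e2: "ip J e q = 0" if "q \<in> Q" for q
      unfolding e_def ip_scale_left b_def using proj_compl_orthogonal[OF Q(1) that] by simp
    have e3: "ip J q e = 0" if "q \<in> Q" for q
      using e2[OF that] cnj_ip[of J e q] by simp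
    have "e \<notin> Q" using e1 e2 by force
    have "orthonormal_in J (insert e Q)"
      using Q(1) e1 e2 e3 \<open>e \<notin> Q\<close> unfolding orthonormal_in_def by auto
    moreover have "card (insert e Q) \<le> length (a # as)"
      using Q(1,2) \<open>e \<notin> Q\<close> by (simp add: orthonormal_in_def)
    moreover have "ip J v a' = 0" if v: "\<forall>q\<in>insert e Q. ip J v q = 0" and a': "a' \<in> set (a # as)" for v a'
    proof (cases "a' \<in> set as")
      case True
      then show ?thesis using Q(3) v by blast
    next
      case False
      have "ip J v b = of_real r * ip J v e"
        unfolding e_def ip_scale_right using \<open>r \<noteq> 0\<close> by simp
      then show ?thesis using b[of v] v a' False by simp
    qed
    ultimately show ?thesis by (intro exI[of _ "insert e Q"]) blast
  qed
qed

section \<open>Largest weights and the Parseval identity for trigonometric polynomials\<close>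

lemma summable_on_superlevel_finite:
  fixes g :: "'a \<Rightarrow> real"
  assumes "g summable_on A" "\<And>k. k \<in> A \<Longrightarrow> g k \<ge> 0" "c > 0"
  shows "finite {k\<in>A. g k \<ge> c}"
proof (rule ccontr)
  assume inf: "infinite {k\<in>A. g k \<ge> c}"
  obtain N :: nat where N: "infsum g A < real N * c"
    using reals_Archimedean3[OF \<open>c > 0\<close>] by blast
  obtain F where F: "finite F" "card F = N" "F \<subseteq> {k\<in>A. g k \<ge> c}"
    using infinite_arbitrarily_large[OF inf] by blast
  have "real N * c = (\<Sum>k\<in>F. c)" using F by simp
  also have "\<dots> \<le> sum g F" using F by (intro sum_mono) auto
  also have "\<dots> \<le> infsum g A" using F assms by (intro finite_sum_le_infsum) auto
  finally show False using N by simp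
qed

text \<open>The threshold \<tau> certifies the choice: after each step it is the last, hence
  smallest, selected value. A maximum among the remaining terms exists because only finitely many
  reach a given positive level.\<close>

lemma exists_largest_terms:
  fixes g :: "'a \<Rightarrow> real"
  assumes g: "g summable_on A" "\<And>k. k \<in> A \<Longrightarrow> g k > 0" and A: "infinite A"
  shows "\<exists>I \<tau>. finite I \<and> I \<subseteq> A \<and> card I = n \<and> \<tau> \<ge> 0 \<and> (\<forall>k\<in>I. g k \<ge> \<tau>) \<and> (\<forall>k\<in>A - I. g k \<le> \<tau>)"
proof (induction n)
  case 0
  have "g k \<le> infsum g A" if "k \<in> A" for k
    using finite_sum_le_infsum[OF g(1), of "{k}"] that g(2) by (simp add: less_imp_le)
  moreover have "infsum g A \<ge> 0" using g(2) by (intro infsum_nonneg) (auto intro: less_imp_le)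
  ultimately show ?case by (intro exI[of _ "{}"] exI[of _ "infsum g A"]) auto
next
  case (Suc n)
  then obtain I \<tau> where I: "finite I" "I \<subseteq> A" "card I = n" "\<forall>k\<in>I. g k \<ge> \<tau>" "\<forall>k\<in>A - I. g k \<le> \<tau>"
    by blast
  obtain k0 where k0: "k0 \<in> A - I" using A I(1) by (metis Diff_infinite_finite finite.emptyI ex_in_conv)
  define S where "S = {k\<in>A. g k \<ge> g k0} - I"
  have "finite S" unfolding S_def
    using summable_on_superlevel_finite[OF g(1), of "g k0"] g(2) k0 by (auto intro: less_imp_le)
  moreover have "k0 \<in> S" using k0 by (simp add: S_def)
  ultimately have "Max (g ` S) \<in> g ` S" by (intro Max_in) auto
  then obtain k where k: "k \<in> S" "g k = Max (g ` S)" by auto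
  have kmax: "g l \<le> g k" if "l \<in> A - I" for l
  proof (cases "l \<in> S")
    case True
    then show ?thesis using k(2) \<open>finite S\<close> by simp
  next
    case False
    then have "g l \<le> g k0" using that by (auto simp: S_def)
    also have "\<dots> \<le> g k" using k(1) by (simp add: S_def)
    finally show ?thesis .
  qed
  show ?case
    using I k(1) g(2)[of k] kmax by (intro exI[of _ "insert k I"] exI[of _ "g k"]) (force simp: S_def)
qed

text \<open>Bathtub principle: after subtracting \<tau> the terms on \<open>I\<close> are
  nonnegative and the others nonpositive, so the indicator of \<open>I\<close> is the best choice of
  p; the mass bound pays for \<tau>.\<close>

lemma sum_weighted_le_largest:
  fixes g p :: "'a \<Rightarrow> real"
  assumes "finite J" "I \<subseteq> J" "\<tau> \<ge> 0" "\<And>k. k \<in> I \<Longrightarrow> g k \<ge> \<tau>" "\<And>k. k \<in> J - I \<Longrightarrow> g k \<le> \<tau>"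
    and p: "\<And>k. k \<in> J \<Longrightarrow> 0 \<le> p k" "\<And>k. k \<in> J \<Longrightarrow> p k \<le> 1" "sum p J \<le> card I"
  shows "(\<Sum>k\<in>J. g k * p k) \<le> sum g I"
proof -
  have "(\<Sum>k\<in>J. (g k - \<tau>) * p k) \<le> (\<Sum>k\<in>J. if k \<in> I then g k - \<tau> else 0)"
  proof (rule sum_mono)
    fix k assume k: "k \<in> J"
    show "(g k - \<tau>) * p k \<le> (if k \<in> I then g k - \<tau> else 0)"
    proof (cases "k \<in> I")
      case True
      then show ?thesis using assms(4)[of k] p(2)[OF k] mult_left_mono[of "p k" 1 "g k - \<tau>"] by simp
    next
      case False
      then show ?thesis using assms(5)[of k] k p(1)[OF k] by (simp add: mult_nonpos_nonneg)
    qed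
  qed
  also have "\<dots> = (\<Sum>k\<in>I. g k - \<tau>)"
    using assms(1,2) by (simp add: sum.If_cases Int_absorb1)
  also have "\<dots> = sum g I - \<tau> * card I" by (simp add: sum_subtractf mult.commute)
  finally have "(\<Sum>k\<in>J. (g k - \<tau>) * p k) \<le> sum g I - \<tau> * card I" .
  moreover have "(\<Sum>k\<in>J. (g k - \<tau>) * p k) = (\<Sum>k\<in>J. g k * p k) - \<tau> * sum p J"
    by (simp add: left_diff_distrib sum_subtractf sum_distrib_left)
  moreover have "\<tau> * sum p J \<le> \<tau> * card I" using p(3) \<open>\<tau> \<ge> 0\<close> by (intro mult_left_mono) auto
  ultimately show ?thesis by linarith
qed

lemma parseval_trig:
  assumes "finite J" "J \<subseteq> Zd d"
  shows "(\<integral>x. (cmod (\<Sum>k\<in>J. b k * char d k x))\<^sup>2 \<partial>torus_measure d) = (\<Sum>k\<in>J. (cmod (b k))\<^sup>2)"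
proof -
  let ?t = "\<lambda>x. \<Sum>k\<in>J. b k * char d k x"
  have t: "torus_cont d ?t" using assms(1) by (rule torus_cont_trig)
  have "(\<integral>x. complex_of_real ((cmod (?t x))\<^sup>2) \<partial>torus_measure d) =
      (\<integral>x. (\<Sum>l\<in>J. cnj (b l) * (?t x * cnj (char d l x))) \<partial>torus_measure d)"
  proof (rule Bochner_Integration.integral_cong[OF refl])
    fix x
    have "complex_of_real ((cmod (?t x))\<^sup>2) = ?t x * (\<Sum>l\<in>J. cnj (b l) * cnj (char d l x))"
      unfolding complex_norm_square by simp
    then show "complex_of_real ((cmod (?t x))\<^sup>2) = (\<Sum>l\<in>J. cnj (b l) * (?t x * cnj (char d l x)))"
      by (simp only: sum_distrib_left mult_ac)
  qed
  also have "\<dots> = (\<Sum>l\<in>J. cnj (b l) * fourier d ?t l)"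
    unfolding fourier_eq
    by (subst Bochner_Integration.integral_sum) (auto intro!: integrable_mult_right integrable_fourier t)
  also have "\<dots> = (\<Sum>l\<in>J. cnj (b l) * b l)"
    using assms by (intro sum.cong refl, subst fourier_trig) auto
  also have "\<dots> = of_real (\<Sum>k\<in>J. (cmod (b k))\<^sup>2)"
    by (simp add: complex_norm_square mult.commute del: of_real_power)
  finally have "of_real (\<integral>x. (cmod (?t x))\<^sup>2 \<partial>torus_measure d) = (of_real (\<Sum>k\<in>J. (cmod (b k))\<^sup>2) :: complex)"
    by (simp only: integral_complex_of_real)
  then show ?thesis by (simp only: of_real_eq_iff)
qed

section \<open>Lower bound for arbitrary linear information\<close>

text \<open>Guarantees that n largest weights exist for every n. The constant frequencies suffice,
  and they are distinct because d \<ge> 1.\<close>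

lemma infinite_Zd:
  assumes "d \<ge> 1"
  shows "infinite (Zd d)"
proof
  assume "finite (Zd d)"
  moreover have "inj (\<lambda>n::int. restrict (\<lambda>_. n) {..<d})"
  proof (rule injI)
    fix m n :: int assume "restrict (\<lambda>_. m) {..<d} = restrict (\<lambda>_. n) {..<d}"
    from fun_cong[OF this, of 0] show "m = n" using assms by simp
  qed
  moreover have "range (\<lambda>n::int. restrict (\<lambda>_. n) {..<d}) \<subseteq> Zd d"
    by (intro image_subsetI) (simp add: Zd_def)
  ultimately have "finite (UNIV :: int set)"
    by (meson finite_imageD finite_subset)
  then show False by (simp add: infinite_UNIV_int)
qed

context weighted_space
begin

lemma Lall_lincomb:
  assumes "L \<in> Lall \<omega> d" "f \<in> Hsp \<omega> d" "g \<in> Hsp \<omega> d"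
  shows "L (\<lambda>x. a * f x + b * g x) = a * L f + b * L g"
  using assms unfolding Lall_def by blast

lemma Lall_trig:
  assumes L: "L \<in> Lall \<omega> d" and J: "finite J" "J \<subseteq> Zd d"
  shows "L (\<lambda>x. \<Sum>k\<in>J. c k * char d k x) = (\<Sum>k\<in>J. c k * L (char d k))"
  using J
proof (induction J rule: finite_induct)
  case empty
  have "(\<lambda>x. 0) \<in> Hsp \<omega> d" using zero_in_Hball by (simp add: Hball_def)
  then show ?case using Lall_lincomb[OF L, of "\<lambda>x. 0" "\<lambda>x. 0" 0 0] by simp
next
  case (insert k J)
  have k: "char d k \<in> Hsp \<omega> d"
    using trig_in_Hsp(1)[of "{k}" "\<lambda>_. 1"] insert.prems by simp
  have s: "(\<lambda>x. \<Sum>k\<in>J. c k * char d k x) \<in> Hsp \<omega> d"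
    using insert by (intro trig_in_Hsp) auto
  show ?case using Lall_lincomb[OF L k s, of "c k" 1] insert by simp
qed

text \<open>\<open>g\<close> and \<open>h = - g\<close> carry the same information, hence get the
  same output \<open>u\<close>, and 2 g = (g - u) - (h - u). Nothing is assumed about \<phi>: both
  error bounds are used almost everywhere, and continuity of \<open>g\<close> then gives every
  x.\<close>

lemma kernel_bound:
  assumes alg: "\<And>f. f \<in> Hball \<omega> d \<Longrightarrow> Linf_norm d (\<lambda>x. f x - \<phi> (map (\<lambda>L. L f) Ls) x) \<le> ereal E"
    and Ls: "set Ls \<subseteq> Lall \<omega> d"
    and J: "finite J" "J \<subseteq> Zd d" and g: "g = (\<lambda>x. \<Sum>k\<in>J. c k * char d k x)" "g \<in> Hball \<omega> d"
    and ker: "\<And>L. L \<in> set Ls \<Longrightarrow> L g = 0" and x: "x \<in> cube d"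
  shows "cmod (g x) \<le> E"
proof -
  define h where "h = (\<lambda>x. - g x)"
  have h': "h = (\<lambda>x. \<Sum>k\<in>J. (- c k) * char d k x)" by (simp add: h_def g(1) sum_negf)
  have "Hnorm \<omega> d h = Hnorm \<omega> d g"
    unfolding h' g(1) by (simp only: trig_in_Hsp(2)[OF J] norm_minus_cancel)
  then have h: "h \<in> Hball \<omega> d"
    using g(2) trig_in_Hsp(1)[OF J, of "\<lambda>k. - c k"] by (simp add: Hball_def h')
  have "\<forall>L\<in>set Ls. L h = L g"
  proof
    fix L assume that: "L \<in> set Ls"
    have "L \<in> Lall \<omega> d" using Ls that by blast
    note trig = Lall_trig[OF this J]
    have "L h = - L g"
      using trig[of "\<lambda>k. - c k"] trig[of c] by (simp add: h_def g(1) sum_negf)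
    then show "L h = L g" using ker[OF that] by simp
  qed
  then have same: "map (\<lambda>L. L h) Ls = map (\<lambda>L. L g) Ls" by (intro map_cong refl) blast
  define u where "u = \<phi> (map (\<lambda>L. L g) Ls)"
  have ae: "AE x in torus_measure d. ereal (cmod (f x - u x)) \<le> ereal E"
    if "f \<in> Hball \<omega> d" "map (\<lambda>L. L f) Ls = map (\<lambda>L. L g) Ls" for f
  proof -
    have "esssup (torus_measure d) (\<lambda>x. ereal (cmod (f x - u x))) \<le> ereal E"
      using alg[OF that(1)] that(2) unfolding Linf_norm_def u_def by simp
    then show ?thesis
      using esssup_AE[of "\<lambda>x. ereal (cmod (f x - u x))" "torus_measure d"]
      by (elim eventually_mono) (rule order_trans)
  qed
  have "AE x in torus_measure d. cmod (g x) \<le> E"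
    using ae[OF g(2) refl] ae[OF h same]
  proof eventually_elim
    case (elim x)
    have "2 * g x = (g x - u x) - (h x - u x)" by (simp add: h_def)
    then have "cmod (2 * g x) \<le> cmod (g x - u x) + cmod (h x - u x)"
      by (metis norm_triangle_ineq4)
    then show ?case using elim by (simp add: norm_mult)
  qed
  moreover have "continuous_on (Rd d) g"
    using g(2) by (auto simp: Hball_def intro: torus_cont_continuous Hsp_torus_cont)
  ultimately show ?thesis using x by (intro AE_torus_imp_everywhere)
qed

text \<open>In the orthonormal basis char / \<omega>, p is the diagonal of the orthogonal projection
  onto the span of \<open>Q\<close>, which contains the representers of the functionals; its trace
  is \<open>card Q\<close>. Averaging over x turns the pointwise bounds into a bound on this
  diagonal.\<close>

lemma algorithm_weights:
  assumes alg: "\<And>f. f \<in> Hball \<omega> d \<Longrightarrow> Linf_norm d (\<lambda>x. f x - \<phi> (map (\<lambda>L. L f) Ls) x) \<le> ereal E"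
    and Ls: "set Ls \<subseteq> Lall \<omega> d" and J: "finite J" "J \<subseteq> Zd d"
  obtains p :: "(nat \<Rightarrow> int) \<Rightarrow> real" where "\<And>k. k \<in> J \<Longrightarrow> 0 \<le> p k" "\<And>k. k \<in> J \<Longrightarrow> p k \<le> 1"
    "sum p J \<le> length Ls" "(\<Sum>k\<in>J. 1 / (\<omega> d k)\<^sup>2 * (1 - p k)) \<le> E\<^sup>2"
proof -
  define s where "s = (\<lambda>k. 1 / \<omega> d k)"
  \<comment> \<open>Representers: for f with coefficients v(k) s(k), k in \<open>J\<close>, the
    inner product of v with such a vector is L f.\<close>
  define as where "as = map (\<lambda>L k. cnj (of_real (s k) * L (char d k))) Ls"
  obtain Q where Q: "orthonormal_in J Q" "card Q \<le> length as"
    "\<And>v a. (\<forall>q\<in>Q. ip J v q = 0) \<Longrightarrow> a \<in> set as \<Longrightarrow> ip J v a = 0"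
    using gram_schmidt[OF J(1), of as] by blast
  define p where "p = (\<lambda>k. \<Sum>q\<in>Q. (cmod (q k))\<^sup>2)"
  \<comment> \<open>Coordinates of the reproducing kernel at x: the inner product of v with
    \<open>w x\<close> is the value at x of the function with coefficients v(k) s(k).\<close>
  define w where "w = (\<lambda>x k. of_real (s k) * cnj (char d k x))"
  have pw: "(\<Sum>k\<in>J. (s k)\<^sup>2) - (\<Sum>q\<in>Q. (cmod (ip J (w x) q))\<^sup>2) \<le> E\<^sup>2" if x: "x \<in> cube d" for x
  proof -
    define v where "v = proj_compl J Q (w x)"
    define N where "N = (\<Sum>k\<in>J. (cmod (v k))\<^sup>2)"
    have N: "N = (\<Sum>k\<in>J. (s k)\<^sup>2) - (\<Sum>q\<in>Q. (cmod (ip J (w x) q))\<^sup>2)"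
      unfolding N_def v_def ip_proj_compl_self(2)[OF Q(1)] by (simp add: w_def norm_mult)
    have "N \<le> E\<^sup>2"
    proof (cases "N > 0")
      case False
      then have "N \<le> 0" by simp
      also have "0 \<le> E\<^sup>2" by simp
      finally show ?thesis .
    next
      case True
      \<comment> \<open>The normalised remainder of the kernel section: a function of norm 1,
        annihilated by all functionals, whose value at x is N / sqrt N = sqrt N.\<close>
      define c where "c = (\<lambda>k. of_real (1 / sqrt N) * v k * of_real (s k))"
      define g where "g = (\<lambda>x. \<Sum>k\<in>J. c k * char d k x)"
      have "(\<Sum>k\<in>J. (cmod (c k) * \<omega> d k)\<^sup>2) = (\<Sum>k\<in>J. (cmod (v k))\<^sup>2 / N)"
      proof (intro sum.cong refl)
        fix k assume k: "k \<in> J"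
        then have "\<omega> d k > 0" using weight_pos J(2) by blast
        then have "cmod (c k) * \<omega> d k = cmod (v k) / sqrt N"
          using True by (simp add: c_def norm_mult norm_divide s_def)
        then show "(cmod (c k) * \<omega> d k)\<^sup>2 = (cmod (v k))\<^sup>2 / N"
          using True by (simp add: power_divide)
      qed
      also have "\<dots> = 1" using True by (simp add: N_def flip: sum_divide_distrib)
      finally have g_ball: "g \<in> Hball \<omega> d"
        using trig_in_Hsp[OF J, of c] by (simp add: Hball_def g_def)
      have g_ker: "L g = 0" if L: "L \<in> set Ls" for L
      proof -
        let ?a = "\<lambda>k. cnj (of_real (s k) * L (char d k))"
        have "?a \<in> set as" using L by (auto simp: as_def)
        moreover have "\<forall>q\<in>Q. ip J v q = 0"
          unfolding v_def using proj_compl_orthogonal[OF Q(1)] by blast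
        ultimately have 0: "ip J v ?a = 0" using Q(3) by blast
        have "L g = (\<Sum>k\<in>J. c k * L (char d k))"
          unfolding g_def using L Ls J by (intro Lall_trig) auto
        also have "\<dots> = of_real (1 / sqrt N) * ip J v ?a"
          by (simp add: ip_def c_def sum_distrib_left mult_ac)
        finally show ?thesis using 0 by simp
      qed
      have "g x = of_real (1 / sqrt N) * ip J v (w x)"
        by (simp add: g_def c_def ip_def w_def sum_distrib_left mult_ac)
      also have "ip J v (w x) = ip J v v"
        unfolding v_def using ip_proj_compl_self(1)[OF Q(1)] by simp
      also have "\<dots> = of_real N" unfolding ip_self N_def ..
      finally have "g x = of_real (N / sqrt N)" by simp
      then have "cmod (g x) = sqrt N" using True by (simp add: real_div_sqrt)
      moreover have "cmod (g x) \<le> E"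
        using alg Ls J g_def g_ball g_ker x by (rule kernel_bound[of \<phi> Ls E J g c x])
      ultimately have "(sqrt N)\<^sup>2 \<le> E\<^sup>2" using True by (intro power_mono) auto
      then show ?thesis using True by simp
    qed
    then show ?thesis using N by simp
  qed
  have ipw: "cmod (ip J (w x) q) = cmod (\<Sum>k\<in>J. (of_real (s k) * q k) * char d k x)" for x q
  proof -
    have "ip J (w x) q = cnj (\<Sum>k\<in>J. (of_real (s k) * q k) * char d k x)"
      by (simp add: ip_def w_def mult_ac)
    then show ?thesis by (metis complex_mod_cnj)
  qed
  have cont: "continuous_on (Rd d) (\<lambda>x. (cmod (\<Sum>k\<in>J. (of_real (s k) * q k) * char d k x))\<^sup>2)" for q
    by (intro continuous_intros)
  \<comment> \<open>Integration over x: the cube has measure 1, and Parseval turns each squared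
    inner product of \<open>w x\<close> with q into a sum over k.\<close>
  have "(\<Sum>k\<in>J. (s k)\<^sup>2) - (\<Sum>q\<in>Q. \<Sum>k\<in>J. (s k)\<^sup>2 * (cmod (q k))\<^sup>2) =
      (\<integral>x. (\<Sum>k\<in>J. (s k)\<^sup>2) - (\<Sum>q\<in>Q. (cmod (\<Sum>k\<in>J. (of_real (s k) * q k) * char d k x))\<^sup>2) \<partial>torus_measure d)"
    by (subst Bochner_Integration.integral_diff)
       (auto intro!: integrable_torus_continuous continuous_intros
         simp: Bochner_Integration.integral_sum[OF integrable_torus_continuous[OF cont]]
           parseval_trig[OF J] norm_mult power_mult_distrib)
  also have "\<dots> \<le> (\<integral>x. E\<^sup>2 \<partial>torus_measure d)"
    using pw unfolding ipw
    by (intro integral_mono integrable_torus_continuous continuous_intros) auto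
  also have "\<dots> = E\<^sup>2" by simp
  finally have "(\<Sum>k\<in>J. (s k)\<^sup>2) - (\<Sum>q\<in>Q. \<Sum>k\<in>J. (s k)\<^sup>2 * (cmod (q k))\<^sup>2) \<le> E\<^sup>2" .
  moreover have "(\<Sum>q\<in>Q. \<Sum>k\<in>J. (s k)\<^sup>2 * (cmod (q k))\<^sup>2) = (\<Sum>k\<in>J. (s k)\<^sup>2 * p k)"
    unfolding p_def by (subst sum.swap) (simp add: sum_distrib_left)
  ultimately have "(\<Sum>k\<in>J. 1 / (\<omega> d k)\<^sup>2 * (1 - p k)) \<le> E\<^sup>2"
    by (simp add: s_def power_divide right_diff_distrib sum_subtractf)
  moreover have "sum p J \<le> length Ls"
  proof -
    have "sum p J = (\<Sum>q\<in>Q. \<Sum>k\<in>J. (cmod (q k))\<^sup>2)" unfolding p_def by (rule sum.swap)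
    also have "\<dots> = (\<Sum>q\<in>Q. 1)"
    proof (intro sum.cong refl)
      fix q assume "q \<in> Q"
      then have "ip J q q = 1" using Q(1) by (simp add: orthonormal_in_def)
      then show "(\<Sum>k\<in>J. (cmod (q k))\<^sup>2) = 1" unfolding ip_self by (simp only: of_real_eq_1_iff)
    qed
    finally show ?thesis using Q(2) by (simp add: as_def)
  qed
  moreover have "p k \<le> 1" if "k \<in> J" for k
    unfolding p_def using Q(1) J(1) that by (rule orthonormal_weights_le_1)
  moreover have "0 \<le> p k" for k unfolding p_def by (intro sum_nonneg) auto
  ultimately show ?thesis using that by blast
qed

text \<open>The infimum over algorithms need not be attained, so the bound is proved for every E' >
  E. The set \<open>I\<close> is fixed beforehand, since it must depend neither on E' nor on the
  finite sets \<open>F\<close> that exhaust the tail.\<close>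

lemma tail_le_of_err_all:
  assumes "d \<ge> 1" and "E \<ge> 0" and err: "err \<omega> d (Lall \<omega> d) n \<le> ereal E"
  obtains I where "finite I" "I \<subseteq> Zd d" "card I = n" "sqrt (tail I) \<le> E"
proof -
  let ?g = "\<lambda>k. 1 / (\<omega> d k)\<^sup>2"
  have g_pos: "?g k > 0" if "k \<in> Zd d" for k
    using weight_pos[OF that] by simp
  obtain I \<tau> where I: "finite I" "I \<subseteq> Zd d" "card I = n" "\<tau> \<ge> 0"
      "\<forall>k\<in>I. ?g k \<ge> \<tau>" "\<forall>k\<in>Zd d - I. ?g k \<le> \<tau>"
    using exists_largest_terms[OF weight_summable g_pos infinite_Zd[OF \<open>d \<ge> 1\<close>], of n] by blast
  have bound: "tail I \<le> E'\<^sup>2" if E': "E' > E" for E'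
  proof -
    have "err \<omega> d (Lall \<omega> d) n < ereal E'" using err E' by (simp add: le_less_trans)
    then obtain Ls \<phi> where Ls: "length Ls = n" "set Ls \<subseteq> Lall \<omega> d"
      and alg: "(SUP f\<in>Hball \<omega> d. Linf_norm d (\<lambda>x. f x - \<phi> (map (\<lambda>L. L f) Ls) x)) < ereal E'"
      unfolding err_def Inf_less_iff by auto
    have alg': "Linf_norm d (\<lambda>x. f x - \<phi> (map (\<lambda>L. L f) Ls) x) \<le> ereal E'" if "f \<in> Hball \<omega> d" for f
      using SUP_upper[OF that, of "\<lambda>f. Linf_norm d (\<lambda>x. f x - \<phi> (map (\<lambda>L. L f) Ls) x)"] alg
      by simp
    show ?thesis
      unfolding tail_def
    proof (rule infsum_le_finite_sums)
      show "?g summable_on Zd d - I" by (rule summable_on_subset_banach[OF weight_summable]) auto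
      fix F assume F: "finite F" "F \<subseteq> Zd d - I"
      define J where "J = F \<union> I"
      have J: "finite J" "J \<subseteq> Zd d" using F I by (auto simp: J_def)
      obtain p :: "(nat \<Rightarrow> int) \<Rightarrow> real" where p: "\<And>k. k \<in> J \<Longrightarrow> 0 \<le> p k" "\<And>k. k \<in> J \<Longrightarrow> p k \<le> 1"
        "sum p J \<le> length Ls" "(\<Sum>k\<in>J. ?g k * (1 - p k)) \<le> E'\<^sup>2"
        using algorithm_weights[of \<phi> Ls E' J, OF alg' Ls(2) J] by blast
      \<comment> \<open>The weights remove at most the sum over \<open>I\<close> from the sum over
        \<open>J\<close>, so at least the sum over \<open>F\<close> is left in the error.\<close>
      have "(\<Sum>k\<in>J. ?g k * p k) \<le> sum ?g I"
        by (rule sum_weighted_le_largest[where \<tau> = \<tau>]) (use I F J p Ls in \<open>auto simp: J_def\<close>)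
      moreover have "sum ?g J = sum ?g F + sum ?g I"
        unfolding J_def using F I by (intro sum.union_disjoint) auto
      ultimately show "sum ?g F \<le> E'\<^sup>2"
        using p(4) by (simp add: right_diff_distrib sum_subtractf)
    qed
  qed
  have "sqrt (tail I) \<le> E + e" if "e > 0" for e
    using bound[of "E + e"] that \<open>E \<ge> 0\<close> by (intro real_le_lsqrt) (auto simp: tail_nonneg)
  then have "sqrt (tail I) \<le> E" by (rule field_le_epsilon)
  then show ?thesis using that I by blast
qed

end

section \<open>Sampling points separating finitely many frequencies\<close>

text \<open>sin x - x / 2 increases up to \<pi> / 3, where cos reaches 1 / 2; beyond, sin x \<ge>
  sqrt 3 / 2 \<ge> 4 / 5 > \<pi> / 4 \<ge> x / 2.\<close>

lemma half_le_sin: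
  assumes "0 \<le> x" "x \<le> pi / 2"
  shows "x / 2 \<le> sin x"
proof (cases "x \<le> pi / 3")
  case True
  have "sin 0 - 0 / 2 \<le> sin x - x / 2"
  proof (rule DERIV_nonneg_imp_nondecreasing[OF assms(1)])
    fix y assume y: "0 \<le> y" "y \<le> x"
    have "cos (pi / 3) \<le> cos y" using y True by (intro cos_monotone_0_pi_le) auto
    then have "0 \<le> cos y - 1 / 2" by (simp add: cos_60)
    moreover have "((\<lambda>x. sin x - x / 2) has_real_derivative cos y - 1 / 2) (at y)"
      by (auto intro!: derivative_eq_intros)
    ultimately show "\<exists>z. ((\<lambda>x. sin x - x / 2) has_real_derivative z) (at y) \<and> 0 \<le> z" by blast
  qed
  then show ?thesis by simp
next
  case False
  have "sin (pi / 3) \<le> sin x" using False assms by (intro sin_monotone_2pi_le) auto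
  moreover have "8 / 5 \<le> sqrt 3" by (rule real_le_rsqrt) (simp add: power2_eq_square)
  moreover have "pi < 16 / 5" using pi_approx by simp
  ultimately show ?thesis using assms(2) by (simp add: sin_60)
qed

text \<open>|cis (2 \<pi> t) - 1| = 2 |sin (\<pi> t)|, and reflecting t to 1 - t where necessary
  brings the argument into the range of \<open>half_le_sin\<close>.\<close>

lemma norm_cis_minus_one_ge:
  assumes "0 \<le> \<delta>" "\<delta> \<le> t" "t \<le> 1 - \<delta>"
  shows "2 * \<delta> \<le> cmod (cis (2 * pi * t) - 1)"
proof -
  have "(cmod (cis (2 * pi * t) - 1))\<^sup>2 = (cos (2 * pi * t) - 1)\<^sup>2 + (sin (2 * pi * t))\<^sup>2"
    by (simp add: cmod_power2)
  also have "\<dots> = 2 - 2 * cos (2 * (pi * t))"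
    using sin_cos_squared_add[of "2 * pi * t"] by (simp add: power2_diff mult.assoc)
  also have "\<dots> = (2 * sin (pi * t))\<^sup>2"
    unfolding cos_double_sin by (simp add: power_mult_distrib)
  finally have "cmod (cis (2 * pi * t) - 1) = \<bar>2 * sin (pi * t)\<bar>"
    by (metis abs_norm_cancel real_sqrt_abs)
  moreover have "\<delta> \<le> sin (pi * t)"
  proof -
    define y where "y = min t (1 - t)"
    have y: "\<delta> \<le> y" "y \<le> 1 / 2" "0 \<le> y" using assms by (auto simp: y_def min_def)
    have "sin (pi * t) = sin (pi * y)"
      by (auto simp: y_def min_def right_diff_distrib)
    moreover have "pi * y / 2 \<le> sin (pi * y)"
      using y mult_left_mono[of y "1/2" pi] by (intro half_le_sin) auto
    moreover have "2 * y \<le> pi * y" using y pi_ge_two by (intro mult_right_mono) auto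
    ultimately show ?thesis using y by linarith
  qed
  ultimately show ?thesis using assms by simp
qed

text \<open>Collapses d dimensions into one. For k \<noteq> l the coordinate differences are the
  coefficients of a nonzero polynomial; finitely many pairs have finitely many roots, and N is any
  integer that avoids them.\<close>

lemma exists_injective_moment:
  assumes "finite I" "I \<subseteq> Zd d"
  shows "\<exists>N::int. inj_on (\<lambda>k. \<Sum>i<d. k i * N ^ i) I"
proof -
  define P where "P = (\<lambda>(k, l). \<Sum>i<d. monom (k i - l i :: int) i)"
  define S where "S = {z\<in>I \<times> I. fst z \<noteq> snd z}"
  have P: "P (k, l) \<noteq> 0" if kl: "(k, l) \<in> S" for k l
  proof -
    have "k \<in> Zd d" "l \<in> Zd d" "k \<noteq> l" using kl assms(2) by (auto simp: S_def)
    then obtain i where i: "i < d" "k i \<noteq> l i"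
      by (auto simp: Zd_def PiE_iff extensional_def fun_eq_iff) (metis)
    have "coeff (P (k, l)) i = (\<Sum>j<d. if j = i then k j - l j else 0)"
      unfolding P_def by (simp add: coeff_sum)
    also have "\<dots> = k i - l i" using i by simp
    finally show ?thesis using i by auto
  qed
  have "finite (\<Union>z\<in>S. {x. poly (P z) x = 0})"
    using assms(1) P by (intro finite_UN_I) (auto simp: S_def intro!: poly_roots_finite)
  then obtain N where N: "N \<notin> (\<Union>z\<in>S. {x. poly (P z) x = 0})"
    by (metis ex_new_if_finite infinite_UNIV_int)
  have "inj_on (\<lambda>k. \<Sum>i<d. k i * N ^ i) I"
  proof (rule inj_onI, rule ccontr)
    fix k l assume kl: "k \<in> I" "l \<in> I" "(\<Sum>i<d. k i * N ^ i) = (\<Sum>i<d. l i * N ^ i)" "k \<noteq> l"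
    then have "poly (P (k, l)) N = 0"
      by (simp add: P_def poly_sum poly_monom left_diff_distrib sum_subtractf)
    moreover have "(k, l) \<in> S" using kl by (simp add: S_def)
    ultimately show False using N by blast
  qed
  then show ?thesis by blast
qed

text \<open>Multiplication by H permutes the residues, and a bad residue has its image within p div
  M of 0 or of p. The lower range contains 0, whence the extra 1.\<close>

lemma card_bad_residues:
  fixes p H M :: int
  assumes "prime p" "\<not> p dvd H" "M > 0"
  shows "int (card {a\<in>{0..<p}. (H * a mod p) * M < p \<or> (p - H * a mod p) * M < p}) \<le> 2 * (p div M) + 1"
proof -
  have "p > 0" using assms(1) by (simp add: prime_gt_0_int)
  let ?f = "\<lambda>a. H * a mod p"
  let ?B = "{a\<in>{0..<p}. ?f a * M < p \<or> (p - ?f a) * M < p}"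
  let ?R = "{0..p div M} \<union> {p - p div M..<p}"
  have inj: "inj_on ?f ?B"
  proof (rule inj_onI)
    fix a b assume ab: "a \<in> ?B" "b \<in> ?B" "?f a = ?f b"
    then have "p dvd H * (a - b)" by (simp add: right_diff_distrib mod_eq_dvd_iff)
    then have "p dvd a - b" using assms(1,2) by (simp add: prime_dvd_mult_iff)
    moreover have "\<bar>a - b\<bar> < p" using ab by auto
    ultimately show "a = b" using zdvd_imp_le[of p "\<bar>a - b\<bar>"] by force
  qed
  have *: "x \<le> p div M" if "x * M < p" for x
    using that zdiv_mono1[of "x * M" p M] assms(3) by simp
  have "?f ` ?B \<subseteq> ?R"
  proof (rule image_subsetI)
    fix a assume a: "a \<in> ?B"
    have "0 \<le> ?f a" "?f a < p" using \<open>p > 0\<close> by auto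
    moreover have "?f a \<le> p div M \<or> p - ?f a \<le> p div M" using a * by blast
    ultimately show "?f a \<in> ?R" by auto
  qed
  then have "card ?B \<le> card ?R"
    by (rule card_inj_on_le[OF inj]) simp
  also have "\<dots> \<le> card {0..p div M} + card {p - p div M..<p}" by (rule card_Un_le)
  finally have "card ?B \<le> nat (p div M + 1) + nat (p div M)" by simp
  moreover have "p div M \<ge> 0" using \<open>p > 0\<close> assms(3) by (simp add: pos_imp_zdiv_nonneg_iff)
  ultimately show ?thesis by linarith
qed

lemma exists_separating_rotation:
  fixes K :: "'a \<Rightarrow> int"
  assumes I: "finite I" "card I \<le> m" and inj: "inj_on K I" and m: "m \<ge> 1"
  shows "\<exists>t::real. \<forall>k\<in>I. \<forall>l\<in>I. k \<noteq> l \<longrightarrow>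
    1 / (2 * real m ^ 2) \<le> cmod (cis (2 * pi * (K k * t)) - cis (2 * pi * (K l * t)))"
proof -
  \<comment> \<open>At most m^2 ordered pairs each exclude at most 2 (p div M) + 1 residues; with M
    = 4 m^2 and p > M this totals less than p / 2 + p / 4. A surviving residue gives the separation
    2 / M.\<close>
  define M where "M = 4 * (int m)\<^sup>2"
  define S where "S = {z\<in>I \<times> I. fst z \<noteq> snd z}"
  have "finite S" using I by (auto simp: S_def)
  have cardS: "card S \<le> m\<^sup>2"
  proof -
    have "card S \<le> card (I \<times> I)" using I by (intro card_mono) (auto simp: S_def)
    also have "\<dots> \<le> m\<^sup>2" using I(2) by (simp add: card_cartesian_product power2_eq_square mult_mono)
    finally show ?thesis .
  qed
  \<comment> \<open>A prime beyond b exceeds M and divides no difference of the values of K at two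
    distinct elements of \<open>I\<close>.\<close>
  define b where "b = Max (insert M ((\<lambda>(k, l). \<bar>K k - K l\<bar>) ` S))"
  obtain p0 :: nat where p0: "prime p0" "p0 > nat b" using bigger_prime by blast
  define p where "p = int p0"
  have p: "prime p" "p > b" using p0 by (auto simp: p_def)
  have "p > M" using p(2) \<open>finite S\<close> unfolding b_def by (subst (asm) Max_less_iff) auto
  have M: "M > 0" using m by (simp add: M_def)
  have ndvd: "\<not> p dvd K k - K l" if "(k, l) \<in> S" for k l
  proof
    assume "p dvd K k - K l"
    moreover have "K k - K l \<noteq> 0" using that inj by (auto simp: S_def inj_on_def)
    moreover have "\<bar>K k - K l\<bar> < p"
    proof -
      have "\<bar>K k - K l\<bar> \<in> (\<lambda>(k, l). \<bar>K k - K l\<bar>) ` S" using that by force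
      then have "\<bar>K k - K l\<bar> \<le> b" unfolding b_def using \<open>finite S\<close> by (intro Max_ge) auto
      then show ?thesis using p(2) by simp
    qed
    ultimately show False using zdvd_imp_le[of p "\<bar>K k - K l\<bar>"] by simp
  qed
  define Bad where "Bad = (\<lambda>(k, l). {a\<in>{0..<p}. ((K k - K l) * a mod p) * M < p \<or> (p - (K k - K l) * a mod p) * M < p})"
  have "card (\<Union>z\<in>S. Bad z) \<le> (\<Sum>z\<in>S. card (Bad z))"
    using \<open>finite S\<close> by (rule card_UN_le)
  then have "int (card (\<Union>z\<in>S. Bad z)) \<le> (\<Sum>z\<in>S. int (card (Bad z)))"
    by (metis of_nat_le_iff of_nat_sum)
  also have "\<dots> \<le> (\<Sum>z\<in>S. 2 * (p div M) + 1)"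
  proof (rule sum_mono)
    fix z assume "z \<in> S"
    then show "int (card (Bad z)) \<le> 2 * (p div M) + 1"
      using card_bad_residues[OF p(1) ndvd M] by (cases z) (auto simp: Bad_def)
  qed
  also have "\<dots> = int (card S) * (2 * (p div M) + 1)" by simp
  also have "\<dots> \<le> (int m)\<^sup>2 * (2 * (p div M) + 1)"
  proof (rule mult_right_mono)
    show "int (card S) \<le> (int m)\<^sup>2" using cardS by (metis of_nat_le_iff of_nat_power)
    show "0 \<le> 2 * (p div M) + 1" using M \<open>p > M\<close> by (simp add: pos_imp_zdiv_nonneg_iff)
  qed
  also have "\<dots> < p"
  proof -
    have "M * (p div M) \<le> p" using M by (simp add: mult.commute minus_mod_eq_mult_div[symmetric])
    then have "4 * ((int m)\<^sup>2 * (p div M)) \<le> p" by (simp add: M_def mult.assoc)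
    moreover have "4 * (int m)\<^sup>2 < p" using \<open>p > M\<close> by (simp add: M_def)
    moreover have "(int m)\<^sup>2 > 0" using m by simp
    ultimately show ?thesis unfolding distrib_left by linarith
  qed
  finally have "card (\<Union>z\<in>S. Bad z) < card {0..<p}" by simp
  moreover have "(\<Union>z\<in>S. Bad z) \<subseteq> {0..<p}" by (auto simp: Bad_def)
  then have "finite (\<Union>z\<in>S. Bad z)" by (rule finite_subset) simp
  ultimately have "\<not> {0..<p} \<subseteq> (\<Union>z\<in>S. Bad z)"
    using card_mono[of "\<Union>z\<in>S. Bad z" "{0..<p}"] by linarith
  then obtain a where a: "a \<in> {0..<p}" "\<And>z. z \<in> S \<Longrightarrow> a \<notin> Bad z" by blast
  have "1 / (2 * real m ^ 2) \<le> cmod (cis (2 * pi * (K k * (a / p))) - cis (2 * pi * (K l * (a / p))))"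
    if kl: "k \<in> I" "l \<in> I" "k \<noteq> l" for k l
  proof -
    define H where "H = K k - K l"
    define r where "r = H * a mod p"
    have "(k, l) \<in> S" using kl by (simp add: S_def)
    then have "p \<le> r * M" "p \<le> (p - r) * M"
      using a(2)[of "(k, l)"] a(1) by (auto simp: Bad_def r_def H_def)
    then have "real_of_int p \<le> real_of_int (r * M)" "real_of_int p \<le> real_of_int ((p - r) * M)"
      by (simp_all only: of_int_le_iff)
    then have r: "1 / M \<le> r / p" "r / p \<le> 1 - 1 / M"
      using M \<open>p > M\<close> by (simp_all add: field_simps)
    have "2 * (1 / real_of_int M) \<le> cmod (cis (2 * pi * (r / p)) - 1)"
      using r M by (intro norm_cis_minus_one_ge) auto
    also have "cis (2 * pi * (r / p)) = cis (2 * pi * (H * (a / p)))"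
    proof -
      have "H * a = p * (H * a div p) + r" by (simp add: r_def)
      then have "real_of_int H * a = p * (H * a div p) + r" by (metis of_int_add of_int_mult)
      then have "H * (a / p) = real_of_int (H * a div p) + r / p"
        using M \<open>p > M\<close> by (simp add: field_simps)
      then show ?thesis by (simp add: distrib_left cis_2pi_int flip: cis_mult)
    qed
    also have "cmod (cis (2 * pi * (H * (a / p))) - 1) =
        cmod (cis (2 * pi * (K l * (a / p))) * (cis (2 * pi * (H * (a / p))) - 1))"
      by (simp add: norm_mult)
    also have "cis (2 * pi * (K l * (a / p))) * (cis (2 * pi * (H * (a / p))) - 1) =
        cis (2 * pi * (K k * (a / p))) - cis (2 * pi * (K l * (a / p)))"
      unfolding right_diff_distrib cis_mult by (simp add: H_def algebra_simps diff_divide_distrib)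
    finally show ?thesis by (simp add: M_def)
  qed
  then show ?thesis by blast
qed

text \<open>With z i = N^i t the inner product of k and z is K(k) t, and the integer parts removed
  by \<open>frac\<close> drop out of the characters. The power formula holds for every k, also
  outside \<open>I\<close>, as the aliasing estimate requires.\<close>

lemma exists_sampling_points:
  assumes I: "finite I" "I \<subseteq> Zd d" "card I \<le> m" and m: "m \<ge> 1"
  obtains x :: "nat \<Rightarrow> nat \<Rightarrow> real" and u :: "(nat \<Rightarrow> int) \<Rightarrow> complex"
  where "\<And>j. x j \<in> cube d" "\<And>k. cmod (u k) = 1" "\<And>k j. char d k (x j) = u k ^ j"
    "\<And>k l. k \<in> I \<Longrightarrow> l \<in> I \<Longrightarrow> k \<noteq> l \<Longrightarrow> 1 / (2 * real m ^ 2) \<le> cmod (u k - u l)"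
proof -
  obtain N :: int where N: "inj_on (\<lambda>k. \<Sum>i<d. k i * N ^ i) I"
    using exists_injective_moment[OF I(1,2)] by blast
  define K where "K = (\<lambda>k. \<Sum>i<d. k i * N ^ i)"
  obtain t :: real where t: "\<forall>k\<in>I. \<forall>l\<in>I. k \<noteq> l \<longrightarrow>
    1 / (2 * real m ^ 2) \<le> cmod (cis (2 * pi * (K k * t)) - cis (2 * pi * (K l * t)))"
    using exists_separating_rotation[OF I(1,3) _ m, of K] N unfolding K_def by blast
  define z where "z = (\<lambda>i. real_of_int (N ^ i) * t)"
  define x where "x = (\<lambda>j::nat. restrict (\<lambda>i. frac (real j * z i)) {..<d})"
  define u where "u = (\<lambda>k. cis (2 * pi * (K k * t)))"
  show ?thesis
  proof (rule that)
    show "x j \<in> cube d" for j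
      by (auto simp: x_def cube_def PiE_iff frac_lt_1[THEN less_imp_le])
    show "cmod (u k) = 1" for k by (simp add: u_def)
    show "1 / (2 * real m ^ 2) \<le> cmod (u k - u l)" if "k \<in> I" "l \<in> I" "k \<noteq> l" for k l
      unfolding u_def using t that by blast
    show "char d k (x j) = u k ^ j" for k j
    proof -
      have "(\<Sum>i<d. real_of_int (k i) * x j i) =
          (\<Sum>i<d. real j * (real_of_int (k i * N ^ i) * t) - real_of_int (k i * \<lfloor>real j * z i\<rfloor>))"
        by (intro sum.cong refl) (auto simp: x_def frac_def z_def algebra_simps)
      also have "\<dots> = real j * (K k * t) - real_of_int (\<Sum>i<d. k i * \<lfloor>real j * z i\<rfloor>)"
        by (simp add: K_def sum_subtractf sum_distrib_left sum_distrib_right)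
      finally have "char d k (x j) = cis (2 * pi * (real j * (K k * t)) - 2 * pi * real_of_int (\<Sum>i<d. k i * \<lfloor>real j * z i\<rfloor>))"
        unfolding char_def by (simp only: right_diff_distrib)
      also have "\<dots> = cis (2 * pi * (real j * (K k * t)))"
        unfolding cis_divide[symmetric] cis_2pi_int by simp
      also have "\<dots> = u k ^ j"
        by (simp only: u_def Complex.DeMoivre mult_ac)
      finally show ?thesis .
    qed
  qed
qed

section \<open>Upper bound for function values\<close>

lemma has_sum_finite_sum:
  fixes f :: "'i \<Rightarrow> 'a \<Rightarrow> 'b :: topological_comm_monoid_add"
  assumes "finite F" "\<And>i. i \<in> F \<Longrightarrow> (f i has_sum S i) A"
  shows "((\<lambda>x. \<Sum>i\<in>F. f i x) has_sum (\<Sum>i\<in>F. S i)) A"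
  using assms by (induction F rule: finite_induct) (auto intro: has_sum_add)

text \<open>Aliasing coefficient: the mean over the samples of a frequency with rotation u, tested
  against one with rotation v.\<close>

definition exp_mean :: "nat \<Rightarrow> complex \<Rightarrow> complex \<Rightarrow> complex" where
  "exp_mean n u v = (\<Sum>j<n. (u * cnj v) ^ j) / of_nat n"

lemma exp_mean_same: "cmod u = 1 \<Longrightarrow> n > 0 \<Longrightarrow> exp_mean n u u = 1"
  by (simp add: exp_mean_def complex_norm_square[symmetric])

lemma norm_exp_mean_le_1:
  assumes "cmod u = 1" "cmod v = 1"
  shows "cmod (exp_mean n u v) \<le> 1"
proof -
  have "cmod (\<Sum>j<n. (u * cnj v) ^ j) \<le> (\<Sum>j<n. cmod ((u * cnj v) ^ j))" by (rule norm_sum)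
  also have "\<dots> = real n" using assms by (simp add: norm_power norm_mult)
  finally show ?thesis by (simp add: exp_mean_def norm_divide divide_le_eq)
qed

text \<open>The ratio q = u conj(v) of the geometric sum satisfies |q - 1| = |u - v|, because v has
  modulus 1, and |q^n - 1| \<le> 2.\<close>

lemma norm_exp_mean_le:
  assumes "cmod u = 1" "cmod v = 1" "n > 0" "0 < r" "r \<le> cmod (u - v)"
  shows "cmod (exp_mean n u v) \<le> 2 / (real n * r)"
proof -
  define q where "q = u * cnj v"
  have "v * cnj v = 1" using assms(2) by (simp add: complex_norm_square[symmetric])
  then have "q - 1 = (u - v) * cnj v" by (simp add: q_def left_diff_distrib)
  then have q1: "cmod (q - 1) = cmod (u - v)" using assms(2) by (simp add: norm_mult)
  have qn: "cmod (q ^ n) = 1" using assms by (simp add: q_def norm_power norm_mult)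
  have "q \<noteq> 1" using q1 assms(4,5) by auto
  then have "(\<Sum>j<n. q ^ j) = (q ^ n - 1) / (q - 1)" by (rule geometric_sum)
  then have "cmod (\<Sum>j<n. q ^ j) = cmod (q ^ n - 1) / cmod (u - v)" by (simp add: norm_divide q1)
  also have "\<dots> \<le> 2 / r"
    using norm_triangle_ineq4[of "q ^ n" 1] qn assms(4,5) by (intro frac_le) auto
  finally have "cmod (\<Sum>j<n. q ^ j) \<le> 2 / r" .
  then have "cmod (\<Sum>j<n. q ^ j) / real n \<le> 2 / r / real n"
    by (intro divide_right_mono) auto
  then show ?thesis by (simp add: exp_mean_def norm_divide q_def mult.commute)
qed

text \<open>For l outside \<open>I\<close>, two elements of \<open>I\<close> with rotations closer
  than 1/(4 m^2) to \<open>u l\<close> would violate \<open>sep\<close>; the single possible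
  exception contributes at most 1. The bound 2 rounds up 3/2.\<close>

lemma sum_exp_mean_le:
  fixes u :: "'a \<Rightarrow> complex"
  assumes I: "finite I" "card I \<le> m" and m: "m \<ge> 1" and n: "n = 16 * m ^ 3"
    and u: "\<And>k. cmod (u k) = 1"
    and sep: "\<And>k l. k \<in> I \<Longrightarrow> l \<in> I \<Longrightarrow> k \<noteq> l \<Longrightarrow> 1 / (2 * real m ^ 2) \<le> cmod (u k - u l)"
  shows "(\<Sum>k\<in>I. if k = l then 0 else cmod (exp_mean n (u l) (u k))) \<le> (if l \<in> I then 1 / 2 else 2)"
proof -
  have "n > 0" using m n by simp
  have far: "cmod (exp_mean n (u l) (u k)) \<le> 1 / (2 * real m)"
    if "1 / (4 * real m ^ 2) \<le> cmod (u l - u k)" for k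
  proof -
    have "cmod (exp_mean n (u l) (u k)) \<le> 2 / (real n * (1 / (4 * real m ^ 2)))"
      using m that \<open>n > 0\<close> by (intro norm_exp_mean_le u) auto
    also have "\<dots> = 1 / (2 * real m)"
      using m by (simp add: n power2_eq_square power3_eq_cube)
    finally show ?thesis .
  qed
  have const: "(\<Sum>k\<in>I. 1 / (2 * real m)) \<le> 1 / 2"
    using I m by (simp add: divide_le_eq)
  have sep': "1 / (4 * real m ^ 2) \<le> cmod (u l - u k)"
    if "k \<in> I" "k0 \<in> I" "k \<noteq> k0" "cmod (u l - u k0) < 1 / (4 * real m ^ 2)" for k k0
  proof -
    have "1 / (2 * real m ^ 2) \<le> cmod (u k - u k0)" using sep that by blast
    also have "u k - u k0 = (u l - u k0) - (u l - u k)" by simp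
    also have "cmod \<dots> \<le> cmod (u l - u k0) + cmod (u l - u k)" by (rule norm_triangle_ineq4)
    finally have "1 / (2 * real m ^ 2) < 1 / (4 * real m ^ 2) + cmod (u l - u k)" using that(4) by simp
    moreover have "1 / (2 * real m ^ 2) = 1 / (4 * real m ^ 2) + 1 / (4 * real m ^ 2)" by simp
    ultimately show ?thesis by linarith
  qed
  show ?thesis
  proof (cases "l \<in> I")
    case True
    have "(\<Sum>k\<in>I. if k = l then 0 else cmod (exp_mean n (u l) (u k))) \<le> (\<Sum>k\<in>I. 1 / (2 * real m))"
    proof (rule sum_mono)
      fix k assume k: "k \<in> I"
      show "(if k = l then 0 else cmod (exp_mean n (u l) (u k))) \<le> 1 / (2 * real m)"
      proof (cases "k = l")
        case False
        then have "1 / (4 * real m ^ 2) \<le> cmod (u l - u k)"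
          using sep'[of k l] k True m by simp
        then show ?thesis using far False by simp
      qed simp
    qed
    then show ?thesis using const True by simp
  next
    case False
    show ?thesis
    proof (cases "\<exists>k0\<in>I. cmod (u l - u k0) < 1 / (4 * real m ^ 2)")
      case True
      then obtain k0 where k0: "k0 \<in> I" "cmod (u l - u k0) < 1 / (4 * real m ^ 2)" by blast
      have "(\<Sum>k\<in>I. if k = l then 0 else cmod (exp_mean n (u l) (u k)))
          \<le> (\<Sum>k\<in>I. 1 / (2 * real m) + (if k = k0 then 1 else 0))"
      proof (rule sum_mono)
        fix k assume k: "k \<in> I"
        show "(if k = l then 0 else cmod (exp_mean n (u l) (u k))) \<le> 1 / (2 * real m) + (if k = k0 then 1 else 0)"
          using norm_exp_mean_le_1[OF u u, of n l k] far[OF sep'[OF k k0(1) _ k0(2)]]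
          by (cases "k = k0") (auto intro: add_increasing)
      qed
      also have "\<dots> \<le> 2" using const k0(1) I(1) by (simp add: sum.distrib)
      finally show ?thesis using False by simp
    next
      case far': False
      have "(\<Sum>k\<in>I. if k = l then 0 else cmod (exp_mean n (u l) (u k))) \<le> (\<Sum>k\<in>I. 1 / (2 * real m))"
        using far far' by (intro sum_mono) (auto simp: not_less)
      then show ?thesis using const False by simp
    qed
  qed
qed

text \<open>Averaging the vanishing conditions against conj(u k)^j expresses a k as minus the sum of
  a l W(l, k) over l \<noteq> k, as W(k, k) = 1. Summing over k in \<open>I\<close> and exchanging
  sums leaves the sums of \<open>sum_exp_mean_le\<close>; for l in \<open>I\<close> they are below
  1, so that part can be absorbed on the left.\<close>

lemma sum_coeffs_le_tail:
  fixes a u :: "'a \<Rightarrow> complex"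
  assumes I: "finite I" "card I \<le> m" "I \<subseteq> A" and m: "m \<ge> 1" and n: "n = 16 * m ^ 3"
    and u: "\<And>k. cmod (u k) = 1"
    and sep: "\<And>k l. k \<in> I \<Longrightarrow> l \<in> I \<Longrightarrow> k \<noteq> l \<Longrightarrow> 1 / (2 * real m ^ 2) \<le> cmod (u k - u l)"
    and summ: "(\<lambda>k. cmod (a k)) summable_on A"
    and zero: "\<And>j. j < n \<Longrightarrow> ((\<lambda>k. a k * u k ^ j) has_sum 0) A"
  shows "(\<Sum>k\<in>I. cmod (a k)) \<le> 4 * (\<Sum>\<^sub>\<infinity>k\<in>A - I. cmod (a k))"
proof -
  have "n > 0" using m n by simp
  define W where "W = (\<lambda>l k. exp_mean n (u l) (u k))"
  define V where "V = (\<lambda>l k. if k = l then 0 else cmod (W l k))"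
  have V1: "V l k \<le> 1" for l k
    using norm_exp_mean_le_1[OF u u] by (simp add: V_def W_def)
  have V0: "V l k \<ge> 0" for l k by (simp add: V_def)
  have sV: "(\<lambda>l. cmod (a l) * V l k) summable_on A" for k
    using Infinite_Sum.abs_summable_on_comparison_test'[OF summ, of "\<lambda>l. cmod (a l) * V l k"] V0 V1
    by (simp add: mult_left_le abs_mult)
  have ak: "cmod (a k) \<le> (\<Sum>\<^sub>\<infinity>l\<in>A. cmod (a l) * V l k)" if k: "k \<in> I" for k
  proof -
    have "((\<lambda>l. \<Sum>j<n. cnj (u k) ^ j / of_nat n * (a l * u l ^ j)) has_sum
        (\<Sum>j<n. cnj (u k) ^ j / of_nat n * 0)) A"
      using zero by (intro has_sum_finite_sum has_sum_cmult_right) auto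
    moreover have "(\<Sum>j<n. cnj (u k) ^ j / of_nat n * (a l * u l ^ j)) = a l * W l k" for l
      by (simp add: W_def exp_mean_def sum_divide_distrib sum_distrib_left power_mult_distrib mult_ac)
    ultimately have hs: "((\<lambda>l. a l * W l k) has_sum 0) A" by simp
    have Wk: "W k k = 1" unfolding W_def using u \<open>n > 0\<close> by (rule exp_mean_same)
    \<comment> \<open>Subtracting the full aliasing sum from the single term at k cancels the
      diagonal while the index set remains \<open>A\<close>.\<close>
    have eqV: "cmod ((if l = k then a l else 0) - a l * W l k) = cmod (a l) * V l k" for l
      using Wk by (cases "l = k") (auto simp: V_def norm_mult)
    have "((\<lambda>l. if l = k then a l else 0) has_sum a k) A"
    proof -
      have "((\<lambda>l. if l = k then a l else 0) has_sum (\<Sum>l\<in>{k}. if l = k then a l else 0)) {k}"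
        by (rule has_sum_finite) simp
      then show ?thesis
        by (subst has_sum_cong_neutral[where T = "{k}" and g = "\<lambda>l. if l = k then a l else 0"])
           (use k I(3) in auto)
    qed
    from has_sum_add[OF this has_sum_cmult_right[OF hs, of "- 1"]]
    have "((\<lambda>l. (if l = k then a l else 0) - a l * W l k) has_sum a k) A" by simp
    then have "a k = (\<Sum>\<^sub>\<infinity>l\<in>A. (if l = k then a l else 0) - a l * W l k)" by (simp add: infsumI)
    also have "cmod \<dots> \<le> (\<Sum>\<^sub>\<infinity>l\<in>A. cmod ((if l = k then a l else 0) - a l * W l k))"
      by (rule norm_infsum_bound) (simp add: eqV sV)
    also have "\<dots> = (\<Sum>\<^sub>\<infinity>l\<in>A. cmod (a l) * V l k)" by (simp only: eqV)
    finally show ?thesis .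
  qed
  define S where "S = (\<Sum>k\<in>I. cmod (a k))"
  define R where "R = (\<Sum>\<^sub>\<infinity>k\<in>A - I. cmod (a k))"
  have hsI: "((\<lambda>l. cmod (a l)) has_sum S) I" unfolding S_def using I(1) by (rule has_sum_finite)
  have hsR: "((\<lambda>l. cmod (a l)) has_sum R) (A - I)"
    unfolding R_def by (intro has_sum_infsum summable_on_subset_banach[OF summ]) auto
  have "((\<lambda>l. cmod (a l) * (if l \<in> I then 1 / 2 else 2)) has_sum S * (1 / 2) + R * 2) (I \<union> (A - I))"
    by (intro has_sum_Un_disjoint)
       (use has_sum_cmult_left[OF hsI, of "1/2"] has_sum_cmult_left[OF hsR, of 2] in
         \<open>auto elim!: has_sum_cong[THEN iffD1, rotated]\<close>)
  moreover have "I \<union> (A - I) = A" using I(3) by blast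
  ultimately have hsB: "((\<lambda>l. cmod (a l) * (if l \<in> I then 1 / 2 else 2)) has_sum S / 2 + 2 * R) A"
    by (simp add: mult.commute)
  have "S \<le> (\<Sum>k\<in>I. \<Sum>\<^sub>\<infinity>l\<in>A. cmod (a l) * V l k)"
    unfolding S_def by (intro sum_mono ak)
  moreover have "((\<lambda>l. \<Sum>k\<in>I. cmod (a l) * V l k) has_sum (\<Sum>k\<in>I. \<Sum>\<^sub>\<infinity>l\<in>A. cmod (a l) * V l k)) A"
    using I(1) sV by (intro has_sum_finite_sum) auto
  then have "(\<Sum>k\<in>I. \<Sum>\<^sub>\<infinity>l\<in>A. cmod (a l) * V l k) \<le> S / 2 + 2 * R"
  proof (rule has_sum_mono[OF _ hsB])
    fix l
    have "(\<Sum>k\<in>I. V l k) \<le> (if l \<in> I then 1 / 2 else 2)"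
      unfolding V_def W_def using I(1,2) m n u sep by (rule sum_exp_mean_le)
    then show "(\<Sum>k\<in>I. cmod (a l) * V l k) \<le> cmod (a l) * (if l \<in> I then 1 / 2 else 2)"
      unfolding sum_distrib_left[symmetric] by (intro mult_left_mono) auto
  qed
  ultimately show ?thesis unfolding S_def[symmetric] R_def[symmetric] by linarith
qed

context weighted_space
begin

text \<open>Any reconstruction from the ball that is consistent with the samples is good enough: its
  difference g to the target vanishes at the sampling points, so the low frequencies of g are
  controlled by the high ones.\<close>

lemma err_std_le:
  assumes I: "finite I" "I \<subseteq> Zd d" "card I \<le> m" and m: "m \<ge> 1"
  shows "err \<omega> d (Lstd d) (16 * m ^ 3) \<le> ereal (10 * sqrt (tail I))"
proof -
  define n where "n = 16 * m ^ 3"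
  obtain x u where x: "\<And>j. x j \<in> cube d" and u: "\<And>k. cmod (u k) = 1"
    and xu: "\<And>k j. char d k (x j) = u k ^ j"
    and sep: "\<And>k l. k \<in> I \<Longrightarrow> l \<in> I \<Longrightarrow> k \<noteq> l \<Longrightarrow> 1 / (2 * real m ^ 2) \<le> cmod (u k - u l)"
    using exists_sampling_points[OF I m] by metis
  define Ls :: "(tfun \<Rightarrow> complex) list" where "Ls = map (\<lambda>j f. f (x j)) [0..<n]"
  \<comment> \<open>\<open>f\<close> itself is a witness for its own sample vector, so the choice is
    meaningful wherever the algorithm is applied to the ball.\<close>
  define \<phi> where "\<phi> = (\<lambda>y. SOME h. h \<in> Hball \<omega> d \<and> map (\<lambda>L. L h) Ls = y)"
  have "err \<omega> d (Lstd d) n \<le> (SUP f\<in>Hball \<omega> d. Linf_norm d (\<lambda>x. f x - \<phi> (map (\<lambda>L. L f) Ls) x))"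
    unfolding err_def
  proof (rule Inf_lower, intro CollectI exI conjI)
    show "length Ls = n" by (simp add: Ls_def)
    show "set Ls \<subseteq> Lstd d" using x by (auto simp: Ls_def Lstd_def)
  qed (rule refl)
  also have "\<dots> \<le> ereal (10 * sqrt (tail I))"
  proof (rule SUP_least)
    fix f assume f: "f \<in> Hball \<omega> d"
    define h where "h = \<phi> (map (\<lambda>L. L f) Ls)"
    have "h \<in> Hball \<omega> d \<and> map (\<lambda>L. L h) Ls = map (\<lambda>L. L f) Ls"
      unfolding h_def \<phi>_def by (rule someI[of _ f]) (use f in simp)
    then have h: "h \<in> Hball \<omega> d" and "\<forall>j<n. h (x j) = f (x j)"
      by (auto simp: Ls_def)
    define g where "g = (\<lambda>x. f x - h x)"
    have gx: "g (x j) = 0" if "j < n" for j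
      using \<open>\<forall>j<n. h (x j) = f (x j)\<close> that by (simp add: g_def)
    have fH: "f \<in> Hsp \<omega> d" "Hnorm \<omega> d f \<le> 1" and hH: "h \<in> Hsp \<omega> d" "Hnorm \<omega> d h \<le> 1"
      using f h by (auto simp: Hball_def)
    have g: "torus_cont d g"
      unfolding g_def using fH hH by (intro torus_cont_diff Hsp_torus_cont)
    have gk: "fourier d g k = fourier d f k - fourier d h k" for k
      unfolding g_def using fH hH by (intro fourier_diff Hsp_torus_cont)
    have le: "cmod (fourier d g k) \<le> cmod (fourier d f k) + cmod (fourier d h k)" for k
      unfolding gk by (rule norm_triangle_ineq4)
    have summ: "(\<lambda>k. cmod (fourier d g k)) summable_on Zd d - J" for J
      by (rule Infinite_Sum.abs_summable_on_comparison_test'[OF summable_on_add[OF fourier_tail(1)[OF fH(1)] fourier_tail(1)[OF hH(1)]]])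
         (rule le)
    note summ0 = summ[of "{}", simplified]
    define R where "R = (\<Sum>\<^sub>\<infinity>k\<in>Zd d - I. cmod (fourier d g k))"
    have "R \<le> (\<Sum>\<^sub>\<infinity>k\<in>Zd d - I. cmod (fourier d f k) + cmod (fourier d h k))"
      unfolding R_def using le
      by (intro infsum_mono summ summable_on_add fourier_tail(1) fH hH)
    also have "\<dots> = (\<Sum>\<^sub>\<infinity>k\<in>Zd d - I. cmod (fourier d f k)) + (\<Sum>\<^sub>\<infinity>k\<in>Zd d - I. cmod (fourier d h k))"
      by (intro infsum_add fourier_tail(1) fH hH)
    also have "\<dots> \<le> 1 * sqrt (tail I) + 1 * sqrt (tail I)"
      using fH hH tail_nonneg
      by (intro add_mono order_trans[OF fourier_tail(2)] mult_right_mono) auto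
    finally have R: "R \<le> 2 * sqrt (tail I)" by simp
    have "(\<Sum>k\<in>I. cmod (fourier d g k)) \<le> 4 * R"
      unfolding R_def
    proof (rule sum_coeffs_le_tail[OF I(1,3,2) m n_def u sep summ0])
      fix j assume "j < n"
      then show "((\<lambda>k. fourier d g k * u k ^ j) has_sum 0) (Zd d)"
        using fourier_series_eq[OF g summ0 x[of j]] gx[of j] by (simp add: xu)
    qed auto
    moreover have "(\<Sum>\<^sub>\<infinity>k\<in>Zd d. cmod (fourier d g k)) = (\<Sum>k\<in>I. cmod (fourier d g k)) + R"
    proof -
      have "Zd d = I \<union> (Zd d - I)" using I(2) by blast
      then have "(\<Sum>\<^sub>\<infinity>k\<in>Zd d. cmod (fourier d g k)) = (\<Sum>\<^sub>\<infinity>k\<in>I \<union> (Zd d - I). cmod (fourier d g k))" by simp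
      also have "\<dots> = (\<Sum>\<^sub>\<infinity>k\<in>I. cmod (fourier d g k)) + R"
        unfolding R_def using I(1) by (intro infsum_Un_disjoint summ) auto
      finally show ?thesis using I(1) by simp
    qed
    ultimately have *: "(\<Sum>\<^sub>\<infinity>k\<in>Zd d. cmod (fourier d g k)) \<le> 10 * sqrt (tail I)" using R by simp
    have "Linf_norm d g \<le> ereal (10 * sqrt (tail I))"
      by (intro Linf_norm_le torus_cont_continuous g order_trans[OF norm_le_infsum_fourier[OF g summ0] *])
    then show "Linf_norm d (\<lambda>x. f x - \<phi> (map (\<lambda>L. L f) Ls) x) \<le> ereal (10 * sqrt (tail I))"
      by (simp add: g_def h_def)
  qed
  finally show ?thesis by (simp add: n_def)
qed

lemma nstar_all_le_std: "nstar \<omega> c (Lall \<omega>) \<epsilon> d \<le> nstar \<omega> c Lstd \<epsilon> d"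
proof -
  have "err \<omega> d (Lall \<omega> d) n \<le> err \<omega> d (Lstd d) n" for n
    unfolding err_def using Lstd_subset_Lall by (intro Inf_superset_mono) blast
  then show ?thesis
    unfolding nstar_def by (intro Inf_superset_mono) (blast intro: order_trans)
qed

text \<open>The factor 10 of the sampling bound is bought by asking for \<epsilon> / 10. That bound
  takes m \<ge> 1 while n may be 0, hence m = n + 1.\<close>

lemma nstar_std_le:
  assumes "d \<ge> 1" "\<epsilon> > 0" and n: "nstar \<omega> c (Lall \<omega>) (\<epsilon> / 10) d = enat n"
  shows "nstar \<omega> c Lstd \<epsilon> d \<le> enat (16 * (n + 1) ^ 3)"
proof -
  obtain r where r: "r \<ge> 0" "CRI \<omega> c d = ereal r" using CRI_real by blast
  let ?A = "{enat n |n. err \<omega> d (Lall \<omega> d) n \<le> ereal (\<epsilon> / 10) * CRI \<omega> c d}"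
  have Inf_eq: "Inf ?A = enat n" using n by (simp add: nstar_def)
  then have "?A \<noteq> {}" by (metis Inf_empty enat.distinct(1) top_enat_def)
  then obtain e where "e \<in> ?A" by blast
  \<comment> \<open>The extended naturals are well ordered, so the infimum is attained and n itself
    satisfies the error bound.\<close>
  then have "Inf ?A \<in> ?A" by (rule wellorder_InfI)
  then have "enat n \<in> ?A" unfolding Inf_eq .
  then have "err \<omega> d (Lall \<omega> d) n \<le> ereal (\<epsilon> / 10 * r)" using r by simp
  then obtain I where I: "finite I" "I \<subseteq> Zd d" "card I = n" "sqrt (tail I) \<le> \<epsilon> / 10 * r"
    using tail_le_of_err_all[OF \<open>d \<ge> 1\<close>, of "\<epsilon> / 10 * r" n] r(1) \<open>\<epsilon> > 0\<close> by auto
  have "err \<omega> d (Lstd d) (16 * (n + 1) ^ 3) \<le> ereal (10 * sqrt (tail I))"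
    using I by (intro err_std_le) auto
  also have "\<dots> \<le> ereal \<epsilon> * CRI \<omega> c d" using I(4) r by simp
  finally show ?thesis unfolding nstar_def by (intro Inf_lower) blast
qed

end

section \<open>From information complexity to the tractability notion\<close>

lemma powr_sum_eventually_ge:
  fixes s t B :: real
  assumes "s > 0" "t > 0"
  shows "\<exists>R. \<forall>d \<epsilon>. 0 < \<epsilon> \<and> \<epsilon> < 1 \<and> 1 / \<epsilon> + real d > R \<longrightarrow> B \<le> (1 + ln (1 / \<epsilon>)) powr s + real d powr t"
proof -
  define B' where "B' = max B 1"
  have B': "B' > 0" "B \<le> B'" by (auto simp: B'_def)
  \<comment> \<open>If 1 / \<epsilon> + d exceeds the sum of the two thresholds, one summand exceeds
    its own, and the corresponding power alone reaches B'. Positivity of B' lets the roots be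
    undone.\<close>
  have "B \<le> (1 + ln (1 / \<epsilon>)) powr s + real d powr t"
    if "0 < \<epsilon>" "\<epsilon> < 1" "1 / \<epsilon> + real d > exp (B' powr (1 / s)) + B' powr (1 / t)" for d :: nat and \<epsilon> :: real
  proof (cases "real d > B' powr (1 / t)")
    case True
    have "B' = (B' powr (1 / t)) powr t" using B' assms by (simp add: powr_powr)
    also have "\<dots> \<le> real d powr t" using True assms by (intro powr_mono2) auto
    finally show ?thesis using B' by (smt (verit) powr_ge_zero)
  next
    case False
    then have "exp (B' powr (1 / s)) < 1 / \<epsilon>" using that by linarith
    then have "ln (exp (B' powr (1 / s))) < ln (1 / \<epsilon>)" by (subst ln_less_cancel_iff) (use that in auto)
    then have le: "B' powr (1 / s) \<le> 1 + ln (1 / \<epsilon>)" by simp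
    have "B' = (B' powr (1 / s)) powr s" using B' assms by (simp add: powr_powr)
    also have "\<dots> \<le> (1 + ln (1 / \<epsilon>)) powr s" using le assms by (intro powr_mono2) auto
    finally show ?thesis using B' by (smt (verit) powr_ge_zero)
  qed
  then show ?thesis by blast
qed

text \<open>Covers complexity 0, since \<open>ln 0\<close> is 0.\<close>

lemma ln_nat_mono: "m \<le> n \<Longrightarrow> ln (real m) \<le> ln (real n)"
  by (cases "m = 0"; cases "n = 0") auto

lemma EXP_WTE:
  assumes "EXP_WT \<omega> c s t \<Lambda>" "\<eta> > 0"
  obtains R where "\<And>d \<epsilon>. d \<ge> 1 \<Longrightarrow> 0 < \<epsilon> \<and> \<epsilon> < 1 \<and> 1 / \<epsilon> + real d > R \<Longrightarrow>
      nstar \<omega> c \<Lambda> \<epsilon> d \<noteq> \<infinity> \<and> ln (real (the_enat (nstar \<omega> c \<Lambda> \<epsilon> d)))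
        \<le> \<eta> * ((1 + ln (1 / \<epsilon>)) powr s + real d powr t)"
proof -
  from assms(1)[unfolded EXP_WT_def, rule_format, OF assms(2)]
  obtain R where R: "\<forall>d\<ge>1. \<forall>\<epsilon>. 0 < \<epsilon> \<and> \<epsilon> < 1 \<and> 1 / \<epsilon> + real d > R \<longrightarrow>
      nstar \<omega> c \<Lambda> \<epsilon> d \<noteq> \<infinity> \<and> ln (real (the_enat (nstar \<omega> c \<Lambda> \<epsilon> d)))
        \<le> \<eta> * ((1 + ln (1 / \<epsilon>)) powr s + real d powr t)" ..
  show ?thesis by (rule that) (rule R[rule_format])
qed

lemma EXP_WT_std_imp_all:
  assumes w: "\<And>d. weighted_space \<omega> d" and "EXP_WT \<omega> c s t Lstd"
  shows "EXP_WT \<omega> c s t (Lall \<omega>)"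
  unfolding EXP_WT_def
proof (intro allI impI)
  fix \<eta> :: real assume "\<eta> > 0"
  then obtain R where R: "\<And>d \<epsilon>. d \<ge> 1 \<Longrightarrow> 0 < \<epsilon> \<and> \<epsilon> < 1 \<and> 1 / \<epsilon> + real d > R \<Longrightarrow>
      nstar \<omega> c Lstd \<epsilon> d \<noteq> \<infinity> \<and> ln (real (the_enat (nstar \<omega> c Lstd \<epsilon> d)))
        \<le> \<eta> * ((1 + ln (1 / \<epsilon>)) powr s + real d powr t)"
    by (rule EXP_WTE[OF assms(2)]) (erule that)
  show "\<exists>R. \<forall>d\<ge>1. \<forall>\<epsilon>. 0 < \<epsilon> \<and> \<epsilon> < 1 \<and> 1 / \<epsilon> + real d > R \<longrightarrow>
      nstar \<omega> c (Lall \<omega>) \<epsilon> d \<noteq> \<infinity> \<and> ln (real (the_enat (nstar \<omega> c (Lall \<omega>) \<epsilon> d)))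
        \<le> \<eta> * ((1 + ln (1 / \<epsilon>)) powr s + real d powr t)"
  proof (rule exI[of _ R], intro allI impI)
    fix d :: nat and \<epsilon> :: real
    assume d: "d \<ge> 1" "0 < \<epsilon> \<and> \<epsilon> < 1 \<and> 1 / \<epsilon> + real d > R"
    obtain N where N: "nstar \<omega> c Lstd \<epsilon> d = enat N" using R[OF d] by auto
    have "nstar \<omega> c (Lall \<omega>) \<epsilon> d \<le> enat N"
      using weighted_space.nstar_all_le_std[OF w, of c \<epsilon> d] N by simp
    then obtain n where n: "nstar \<omega> c (Lall \<omega>) \<epsilon> d = enat n" "n \<le> N"
      by (cases "nstar \<omega> c (Lall \<omega>) \<epsilon> d") auto
    show "nstar \<omega> c (Lall \<omega>) \<epsilon> d \<noteq> \<infinity> \<and> ln (real (the_enat (nstar \<omega> c (Lall \<omega>) \<epsilon> d)))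
        \<le> \<eta> * ((1 + ln (1 / \<epsilon>)) powr s + real d powr t)"
      using R[OF d] N n ln_nat_mono[OF n(2)] by simp
  qed
qed

text \<open>Half of \<eta> pays for the exponent 3 in 16 (n + 1)^3, the other half for the
  constants, which are negligible once 1 / \<epsilon> + d is large.\<close>

lemma EXP_WT_all_imp_std:
  assumes w: "\<And>d. weighted_space \<omega> d" and "s > 0" "t > 0" and "EXP_WT \<omega> c s t (Lall \<omega>)"
  shows "EXP_WT \<omega> c s t Lstd"
  unfolding EXP_WT_def
proof (intro allI impI)
  fix \<eta> :: real assume \<eta>: "\<eta> > 0"
  \<comment> \<open>Comes from 1 + ln (10 / \<epsilon>) \<le> (1 + ln 10) (1 + ln (1 /
    \<epsilon>)).\<close>
  define D where "D = (1 + ln 10 :: real) powr s"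
  have "D \<ge> 1" unfolding D_def using \<open>s > 0\<close> by (intro ge_one_powr_ge_zero) auto
  \<comment> \<open>The 6 is the exponent 3 against half of \<eta>; D undoes the passage from
    \<epsilon> to \<epsilon> / 10.\<close>
  define \<eta>' where "\<eta>' = \<eta> / (6 * D)"
  have "\<eta>' > 0" using \<eta> \<open>D \<ge> 1\<close> by (simp add: \<eta>'_def)
  then obtain R where R: "\<And>d \<epsilon>. d \<ge> 1 \<Longrightarrow> 0 < \<epsilon> \<and> \<epsilon> < 1 \<and> 1 / \<epsilon> + real d > R \<Longrightarrow>
      nstar \<omega> c (Lall \<omega>) \<epsilon> d \<noteq> \<infinity> \<and> ln (real (the_enat (nstar \<omega> c (Lall \<omega>) \<epsilon> d)))
        \<le> \<eta>' * ((1 + ln (1 / \<epsilon>)) powr s + real d powr t)"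
    by (rule EXP_WTE[OF assms(4)]) (erule that)
  \<comment> \<open>ln 128 = ln 16 + 3 ln 2 collects the constants, the second part coming from n +
    1 \<le> 2 n for n \<ge> 1.\<close>
  obtain R' where R': "\<And>d \<epsilon>. 0 < \<epsilon> \<and> \<epsilon> < 1 \<and> 1 / \<epsilon> + real d > R' \<Longrightarrow>
      2 * ln 128 / \<eta> \<le> (1 + ln (1 / \<epsilon>)) powr s + real d powr t"
    using powr_sum_eventually_ge[OF \<open>s > 0\<close> \<open>t > 0\<close>] by metis
  show "\<exists>R. \<forall>d\<ge>1. \<forall>\<epsilon>. 0 < \<epsilon> \<and> \<epsilon> < 1 \<and> 1 / \<epsilon> + real d > R \<longrightarrow>
      nstar \<omega> c Lstd \<epsilon> d \<noteq> \<infinity> \<and> ln (real (the_enat (nstar \<omega> c Lstd \<epsilon> d)))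
        \<le> \<eta> * ((1 + ln (1 / \<epsilon>)) powr s + real d powr t)"
  proof (rule exI[of _ "max R R'"], intro allI impI)
    fix d :: nat and \<epsilon> :: real
    assume d: "d \<ge> 1" and \<epsilon>: "0 < \<epsilon> \<and> \<epsilon> < 1 \<and> 1 / \<epsilon> + real d > max R R'"
    define X where "X = (1 + ln (1 / \<epsilon>)) powr s + real d powr t"
    have "1 / \<epsilon> \<le> 1 / (\<epsilon> / 10)" using \<epsilon> by (simp add: field_simps)
    then have \<epsilon>': "0 < \<epsilon> / 10 \<and> \<epsilon> / 10 < 1 \<and> 1 / (\<epsilon> / 10) + real d > R" using \<epsilon> by linarith
    obtain n where n: "nstar \<omega> c (Lall \<omega>) (\<epsilon> / 10) d = enat n" using R[OF d \<epsilon>'] by auto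
    have "ln (1 / \<epsilon>) \<ge> 0" using \<epsilon> by simp
    have "(1 + ln (1 / (\<epsilon> / 10))) powr s \<le> ((1 + ln 10) * (1 + ln (1 / \<epsilon>))) powr s"
    proof (rule powr_mono2)
      have "ln (1 / (\<epsilon> / 10)) = ln 10 + ln (1 / \<epsilon>)" using \<epsilon> by (simp add: ln_div)
      moreover have "0 \<le> ln 10 * ln (1 / \<epsilon>)" using \<open>ln (1 / \<epsilon>) \<ge> 0\<close> by simp
      ultimately show "1 + ln (1 / (\<epsilon> / 10)) \<le> (1 + ln 10) * (1 + ln (1 / \<epsilon>))"
        by (simp add: algebra_simps)
      show "0 \<le> 1 + ln (1 / (\<epsilon> / 10))" using \<epsilon>' by (intro add_nonneg_nonneg ln_ge_zero) auto
    qed (use \<open>s > 0\<close> in simp)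
    also have "\<dots> = D * (1 + ln (1 / \<epsilon>)) powr s"
      using \<open>ln (1 / \<epsilon>) \<ge> 0\<close> by (simp add: D_def powr_mult)
    finally have "(1 + ln (1 / (\<epsilon> / 10))) powr s + real d powr t \<le> D * X"
      using \<open>D \<ge> 1\<close> mult_right_mono[of 1 D "real d powr t"] by (simp add: X_def distrib_left)
    then have "\<eta>' * ((1 + ln (1 / (\<epsilon> / 10))) powr s + real d powr t) \<le> \<eta>' * (D * X)"
      using \<open>\<eta>' > 0\<close> by (intro mult_left_mono) auto
    also have "\<dots> = \<eta> / 6 * X" using \<open>D \<ge> 1\<close> by (simp add: \<eta>'_def)
    finally have ln_n: "ln (real n) \<le> \<eta> / 6 * X" using R[OF d \<epsilon>'] n by simp
    have "2 * ln 128 / \<eta> \<le> X" unfolding X_def by (rule R') (use \<epsilon> in simp)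
    then have X: "ln 128 \<le> \<eta> / 2 * X" using \<eta> by (simp add: field_simps)
    have "nstar \<omega> c Lstd \<epsilon> d \<le> enat (16 * (n + 1) ^ 3)"
      using \<epsilon> by (intro weighted_space.nstar_std_le[OF w d _ n]) auto
    then obtain N where N: "nstar \<omega> c Lstd \<epsilon> d = enat N" "N \<le> 16 * (n + 1) ^ 3"
      by (cases "nstar \<omega> c Lstd \<epsilon> d") auto
    have "ln (real N) \<le> ln (real (16 * (n + 1) ^ 3))" using N(2) by (rule ln_nat_mono)
    also have "\<dots> = ln 16 + 3 * ln (real (n + 1))"
      by (simp add: ln_mult ln_realpow)
    \<comment> \<open>For n = 0 this reads 0 \<le> ln 2, as \<open>ln 0\<close> is 0.\<close>
    also have "ln (real (n + 1)) \<le> ln 2 + ln (real n)"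
    proof (cases "n = 0")
      case False
      then have "ln (real (n + 1)) \<le> ln (2 * real n)" by simp
      then show ?thesis using False by (simp add: ln_mult)
    qed simp
    also have "ln 16 + 3 * (ln 2 + ln (real n)) = ln 128 + 3 * ln (real n)"
    proof -
      have "ln (128 :: real) = ln (16 * 2 ^ 3)" by simp
      also have "\<dots> = ln 16 + ln (2 ^ 3)" by (rule ln_mult_pos) auto
      also have "ln (2 ^ 3 :: real) = 3 * ln 2" by (subst ln_realpow) auto
      finally show ?thesis by simp
    qed
    also have "\<dots> \<le> \<eta> * X" using ln_n X by linarith
    finally show "nstar \<omega> c Lstd \<epsilon> d \<noteq> \<infinity> \<and> ln (real (the_enat (nstar \<omega> c Lstd \<epsilon> d)))
        \<le> \<eta> * ((1 + ln (1 / \<epsilon>)) powr s + real d powr t)"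
      using N(1) by (simp add: X_def)
  qed
qed

theorem theorem4p4:
  fixes \<omega> :: "nat \<Rightarrow> (nat \<Rightarrow> int) \<Rightarrow> real" and c :: crit and s t :: real
  assumes "\<And>d k. k \<in> Zd d \<Longrightarrow> \<omega> d k > 0"
    and "\<And>d. (\<lambda>k. 1 / (\<omega> d k)\<^sup>2) summable_on Zd d"
    and "s > 0" and "t > 0"
  shows "(EXP_WT \<omega> c s t (Lall \<omega>) \<longleftrightarrow> EXP_WT \<omega> c s t Lstd)
       \<and> (EXP_WT \<omega> c 1 1 (Lall \<omega>) \<longleftrightarrow> EXP_WT \<omega> c 1 1 Lstd)"
proof -
  have "weighted_space \<omega> d" for d
    using assms(1,2) by unfold_locales auto
  then have "EXP_WT \<omega> c s' t' (Lall \<omega>) \<longleftrightarrow> EXP_WT \<omega> c s' t' Lstd" if "s' > 0" "t' > 0" for s' t'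
    using EXP_WT_std_imp_all EXP_WT_all_imp_std that by blast
  then show ?thesis using assms(3,4) by simp
qed

end
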